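(* Let $g\in C^1(\mathbb{R}^n)$ and $u(x,t)=\min_{|x-y|\le t}g(y)$. Then $\Sigma\cup T_1$ is composed of at most countably many connected components or almost connected components. That is, $\Sigma\cup T_1=\bigcup_j S_j$ (an at most countable union), where each $S_j$ is either a connected component or an almost connected component of $\Sigma\cup T_1$, and each $S_j$ is a finite or countable union of some of the sets $T(F_i)$.
   Context: $|\cdot|$ is the Euclidean norm. $u$ is the Hopf–Lax solution of $u_t+|\nabla u|=0$ with $u(\cdot,0)=g$. A point $y$ is a minimizer for $(x,t)$ if $|y-x|\le t$ and $u(x,t)=g(y)$. For $y_0$ with $Dg(y_0)\ne0$ put $X(y_0,t)=y_0+\frac{Dg(y_0)}{|Dg(y_0)|}t$ and define, in $[0,\infty]$, $\overline t_s(y_0)=\sup\{t>0 : y_0$ is the unique minimizer for $(X(y_0,t),t)\}$ and $t_s(y_0)=\inf\{t>0 : y_0$ is not a minimizer for $(X(y_0,t),t)\}$ (with $\sup\emptyset=0$, $\inf\emptyset=\infty$); one has $\overline t_s\le t_s$. $M=\{y_0 : Dg(y_0)\neq0,\ \overline t_s(y_0)<\infty\}$. For $S\subset M$, $T(S)$ is the set of points $(X(y_0,t),t)$ with $y_0\in S$ and $t\in[\overline t_s(y_0),t_s(y_0)]$ if $t_s(y_0)<\infty$, $t\in[\overline t_s(y_0),\infty)$ if $t_s(y_0)=\infty$. $\Sigma\subset\mathbb{R}^n\times\{t>0\}$ is the set of points where $u$ is not differentiable. $T_1$ is the set of points of $T(M)$ that have a unique minimizer. $H_{y_0}=\{y :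 (y-y_0)\cdot Dg(y_0)>0\}$ and $E=\{y_0 : Dg(y_0)\ne0,\ \exists\,\bar y\in H_{y_0}$ with $g(\bar y)<g(y_0)\}$. The $E_i$ are the path connected components of $E$. For $y_0$ with $Dg(y_0)\neq 0$, $H^+(y_0)$ is the set of points $y$ in a small neighborhood of $y_0$ (on which the level set $\{g=g(y_0)\}$ is a $C^1$ hypersurface separating the neighborhood) with $g(y)>g(y_0)$. $F_i$ is the union of $E_i$ with all $y_0\in M\setminus E$ for which there is a neighborhood $U$ of $y_0$ with $U\cap H^+(y_0)\subset E_i$. A set $C$ is almost connected if for any two disjoint nonempty (relatively) closed subsets $A,B$ of $C$ with $C=A\cup B$ one has $\mathrm{dist}(A,B)=\inf_{a\in A,b\in B}|a-b|=0$. A (connected, almost connected) component of a set is a maximal (connected, almost connected) subset. *)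

theory Defs
  imports "HOL-Analysis.Analysis"
begin

definition grad :: "(real^'n \<Rightarrow> real) \<Rightarrow> real^'n \<Rightarrow> real^'n" where
  "grad g y = (THE D. GDERIV g y :> D)"

lemma grad_eqI:
  assumes "GDERIV g y :> D"
  shows "grad g y = D"
proof -
  have "D' = D" if "GDERIV g y :> D'" for D'
  proof -
    have "(\<lambda>h. h \<bullet> D') = (\<lambda>h. h \<bullet> D)"
      using that assms unfolding gderiv_def by (rule has_derivative_unique)
    then have "h \<bullet> D' = h \<bullet> D" for h by (rule fun_cong)
    then show ?thesis using vector_eq_ldot by blast
  qed
  with assms show ?thesis unfolding grad_def by (rule the_equality)
qed

definition C1 :: "(real^'n \<Rightarrow> real) \<Rightarrow> bool" where
  "C1 g \<longleftrightarrow> (\<forall>y. g differentiable (at y)) \<and> continuous_on UNIV (grad g)"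

text \<open>For continuous \<open>g\<close> and \<open>t \<ge> 0\<close> the infimum below is a minimum
  (\<open>u_attained\<close>); for \<open>t < 0\<close> the ball is empty and the value is never used.\<close>

definition u :: "(real^'n \<Rightarrow> real) \<Rightarrow> real^'n \<Rightarrow> real \<Rightarrow> real" where
  "u g x t = (INF y\<in>cball x t. g y)"

lemma u_attained:
  assumes "continuous_on UNIV g" "0 \<le> t"
  shows "\<exists>y\<in>cball x t. u g x t = g y \<and> (\<forall>z\<in>cball x t. g y \<le> g z)"
proof -
  have "\<exists>y\<in>cball x t. \<forall>z\<in>cball x t. g y \<le> g z"
    using assms by (intro continuous_attains_inf) (auto intro: continuous_on_subset)
  then obtain y where y: "y \<in> cball x t" "\<forall>z\<in>cball x t. g y \<le> g z" by blast
  then have "u g x t = g y"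
    unfolding u_def by (intro cInf_eq_minimum) (auto simp del: mem_cball)
  with y show ?thesis by blast
qed

definition minimizer :: "(real^'n \<Rightarrow> real) \<Rightarrow> real^'n \<Rightarrow> real \<Rightarrow> real^'n \<Rightarrow> bool" where
  "minimizer g x t y \<longleftrightarrow> norm (y - x) \<le> t \<and> u g x t = g y"

definition X :: "(real^'n \<Rightarrow> real) \<Rightarrow> real^'n \<Rightarrow> real \<Rightarrow> real^'n" where
  "X g y0 t = y0 + t *\<^sub>R (grad g y0 /\<^sub>R norm (grad g y0))"

text \<open>In \<^typ>\<open>ennreal\<close> (that is, \<open>[0,\<infinity>]\<close>) the supremum of the empty set is \<open>0\<close>
  and the infimum of the empty set is \<open>\<infinity>\<close>.\<close>

definition ts_bar :: "(real^'n \<Rightarrow> real) \<Rightarrow> real^'n \<Rightarrow> ennreal" where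
  "ts_bar g y0 = Sup {ennreal t | t. t > 0 \<and> minimizer g (X g y0 t) t y0 \<and>
     (\<forall>y. minimizer g (X g y0 t) t y \<longrightarrow> y = y0)}"

definition ts :: "(real^'n \<Rightarrow> real) \<Rightarrow> real^'n \<Rightarrow> ennreal" where
  "ts g y0 = Inf {ennreal t | t. t > 0 \<and> \<not> minimizer g (X g y0 t) t y0}"

definition M :: "(real^'n \<Rightarrow> real) \<Rightarrow> (real^'n) set" where
  "M g = {y0. grad g y0 \<noteq> 0 \<and> ts_bar g y0 < \<infinity>}"

text \<open>As \<open>t\<close> is a (finite) real number, the constraint \<open>ennreal t \<le> ts g y0\<close> covers both the closed
  interval (\<open>ts g y0 < \<infinity>\<close>) and the half-line (\<open>ts g y0 = \<infinity>\<close>). The value \<open>t = 0\<close> occurs exactly when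
  \<open>ts_bar g y0 = 0\<close>.\<close>

definition T :: "(real^'n \<Rightarrow> real) \<Rightarrow> (real^'n) set \<Rightarrow> ((real^'n) \<times> real) set" where
  "T g S = {(X g y0 t, t) | y0 t. y0 \<in> S \<and> 0 \<le> t \<and> ts_bar g y0 \<le> ennreal t \<and> ennreal t \<le> ts g y0}"

definition Sigma_sing :: "(real^'n \<Rightarrow> real) \<Rightarrow> ((real^'n) \<times> real) set" where
  "Sigma_sing g = {(x, t). t > 0 \<and> \<not> (\<lambda>(x, t). u g x t) differentiable (at (x, t))}"

definition T1 :: "(real^'n \<Rightarrow> real) \<Rightarrow> ((real^'n) \<times> real) set" where
  "T1 g = {(x, t). (x, t) \<in> T g (M g) \<and> (\<exists>!y. minimizer g x t y)}"

definition H :: "(real^'n \<Rightarrow> real) \<Rightarrow> real^'n \<Rightarrow> (real^'n) set" where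
  "H g y0 = {y. (y - y0) \<bullet> grad g y0 > 0}"

definition E :: "(real^'n \<Rightarrow> real) \<Rightarrow> (real^'n) set" where
  "E g = {y0. grad g y0 \<noteq> 0 \<and> (\<exists>y\<in>H g y0. g y < g y0)}"

definition path_components :: "'a::topological_space set \<Rightarrow> 'a set set" where
  "path_components A = path_component_set A ` A"

text \<open>The set \<open>H\<^sup>+(y0)\<close> is \<open>{y \<in> N. g y > g y0}\<close> for a small neighbourhood \<open>N\<close> of \<open>y0\<close>. It is only
  ever intersected with an existentially quantified neighbourhood \<open>U\<close>, so only its germ at \<open>y0\<close>
  matters and \<open>N\<close> is absorbed into \<open>U\<close>.\<close>

definition Hplus :: "(real^'n \<Rightarrow> real) \<Rightarrow> (real^'n) set \<Rightarrow> real^'n \<Rightarrow> (real^'n) set" where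
  "Hplus g U y0 = {y \<in> U. g y > g y0}"

definition F :: "(real^'n \<Rightarrow> real) \<Rightarrow> (real^'n) set \<Rightarrow> (real^'n) set" where
  "F g Ei = Ei \<union> {y0 \<in> M g - E g. \<exists>U. open U \<and> y0 \<in> U \<and> Hplus g U y0 \<subseteq> Ei}"

definition almost_connected :: "'a::metric_space set \<Rightarrow> bool" where
  "almost_connected C \<longleftrightarrow>
     (\<forall>A B. closedin (top_of_set C) A \<and> closedin (top_of_set C) B \<and> A \<noteq> {} \<and> B \<noteq> {} \<and>
        A \<inter> B = {} \<and> C = A \<union> B \<longrightarrow> setdist A B = 0)"

text \<open>As for the library constant \<^const>\<open>components\<close>, components are nonempty
  (cf.\ \<open>in_components_maximal\<close>).\<close>

definition almost_components :: "'a::metric_space set \<Rightarrow> 'a set set" where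
  "almost_components W = {C. C \<noteq> {} \<and> C \<subseteq> W \<and> almost_connected C \<and>
     (\<forall>D. C \<subseteq> D \<and> D \<subseteq> W \<and> almost_connected D \<longrightarrow> D = C)}"

end

theory Submission
  imports Defs
begin

text \<open>
  The family \<open>\<S>\<close> consists of all almost components of \<open>W = Sigma_sing g \<union> T1 g\<close>. Almost connected
  sets with a common point have an almost connected union, so the almost components partition \<open>W\<close>.
  It remains to write \<open>W\<close> as a countable union of almost connected sets \<open>T g (F g Ei)\<close>: each almost
  component then absorbs every one of these sets that it meets (\<open>almost_components_countable_union\<close>).

  First, \<open>W = T g (M g)\<close> (\<open>Sigma_T1_eq\<close>). A minimizer \<open>y\<close> for \<open>(x, t)\<close> with non-zero gradient
  satisfies \<open>x = X g y t\<close> (\<open>minimizer_on_ray\<close>). Carrying a minimizer along with the ball gives a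
  candidate for the derivative of \<open>u\<close>, and \<open>u\<close> is differentiable when all minimizers give the same
  candidate (\<open>u_differentiable\<close>); conversely, differentiability forces equal gradients at all
  minimizers.

  Secondly, \<open>M g\<close> is the union of the sets \<open>F g Ei\<close> (\<open>M_eq_Union_F\<close>). As \<open>E g\<close> is open, there
  are only countably many \<open>Ei\<close>. A point \<open>z\<close> of \<open>M g\<close> outside \<open>E g\<close> has a competitor of equal value
  in its half space, so points near \<open>z\<close> of larger value lie in \<open>E g\<close>, and there they form a
  connected piece.

  Thirdly, \<open>T g (F g Ei)\<close> is almost connected (\<open>almost_connected_T_F\<close>). It is a union of segments
  \<open>{(X g z t, t). t \<in> fibre g z}\<close>. If it were the union of two parts at distance \<open>\<epsilon> > 0\<close>, each
  segment would lie in one part, which colours the points of \<open>F g Ei\<close>, and the colour must be shown to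
  be locally constant. The difficulty is that the end \<open>ts g z\<close> of a characteristic is only upper
  semicontinuous in \<open>z\<close>: as \<open>g\<close> is merely continuously differentiable, characteristics starting
  arbitrarily close to \<open>y\<close> may end long before that of \<open>y\<close> enters its singular segment. The lemma
  \<open>colour_constant_near\<close> overcomes this by descending in time in steps shorter than \<open>\<epsilon>\<close>. If near
  \<open>(X g y \<tau>, \<tau>)\<close> there were singular points of the colour opposite to the one of \<open>y\<close>, while the points
  whose characteristics survive until \<open>\<tau>\<close> have the colour of \<open>y\<close>, then \<open>u\<close> would have unique
  minimizers at time \<open>\<tau>\<close> there. By invariance of domain these would fill a full neighbourhood, and no
  characteristic could have ended earlier.
\<close>

section \<open>Ball geometry along a ray\<close>

definition dir :: "(real^'n \<Rightarrow> real) \<Rightarrow> real^'n \<Rightarrow> real^'n" where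
  "dir g z = grad g z /\<^sub>R norm (grad g z)"

definition ray_min :: "(real^'n \<Rightarrow> real) \<Rightarrow> real^'n \<Rightarrow> real \<Rightarrow> bool" where
  "ray_min g z t \<longleftrightarrow> (\<forall>y\<in>cball (X g z t) t. g z \<le> g y)"

definition ray_strict_min :: "(real^'n \<Rightarrow> real) \<Rightarrow> real^'n \<Rightarrow> real \<Rightarrow> bool" where
  "ray_strict_min g z t \<longleftrightarrow> (\<forall>y\<in>cball (X g z t) t. y \<noteq> z \<longrightarrow> g z < g y)"

text \<open>The times \<open>t\<close> with \<open>ts_bar g z \<le> t \<le> ts g z\<close>, for \<open>C1 g\<close> and \<open>grad g z \<noteq> 0\<close>, in a form that
  avoids extended reals: being a minimizer is inherited by smaller times, and so is being the only one.\<close>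

definition fibre :: "(real^'n \<Rightarrow> real) \<Rightarrow> real^'n \<Rightarrow> real set" where
  "fibre g z = {t. 0 \<le> t \<and> ray_min g z t \<and> (\<forall>s>t. \<not> ray_strict_min g z s)}"

lemma X_eq: "X g z t = z + t *\<^sub>R dir g z"
  by (simp add: X_def dir_def)

lemma norm_dir: "grad g z \<noteq> 0 \<Longrightarrow> norm (dir g z) = 1"
  by (simp add: dir_def)

lemma inner_grad_eq_dir: "v \<bullet> grad g z = norm (grad g z) * (v \<bullet> dir g z)"
  by (cases "grad g z = 0") (simp_all add: dir_def)

lemma dist_X_base: "grad g z \<noteq> 0 \<Longrightarrow> 0 \<le> t \<Longrightarrow> dist (X g z t) z = t"
  by (simp add: X_eq dist_norm norm_dir)

lemma dist_power2_X:
  assumes "grad g z \<noteq> 0"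
  shows "(dist (X g z t) y)\<^sup>2 = (norm (y - z))\<^sup>2 - 2 * t * ((y - z) \<bullet> dir g z) + t\<^sup>2"
proof -
  have 1: "dir g z \<bullet> dir g z = 1"
    using norm_dir[OF assms] by (simp add: norm_eq_1)
  have "(dist (X g z t) y)\<^sup>2 = (norm ((y - z) - t *\<^sub>R dir g z))\<^sup>2"
    by (simp add: X_eq dist_norm norm_minus_commute algebra_simps)
  also have "\<dots> = (norm (y - z))\<^sup>2 - 2 * t * ((y - z) \<bullet> dir g z) + t\<^sup>2"
    unfolding power2_norm_eq_inner
    by (simp only: inner_diff_left[of "y - z"] inner_diff_right[of _ "y - z"])
      (simp add: 1 power2_eq_square inner_commute algebra_simps)
  finally show ?thesis .
qed

lemma mem_cball_X:
  assumes "grad g z \<noteq> 0" "0 \<le> t"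
  shows "y \<in> cball (X g z t) t \<longleftrightarrow> (norm (y - z))\<^sup>2 \<le> 2 * t * ((y - z) \<bullet> dir g z)"
proof -
  have "y \<in> cball (X g z t) t \<longleftrightarrow> (dist (X g z t) y)\<^sup>2 \<le> t\<^sup>2"
    using assms(2) by (simp add: power2_le_iff_abs_le)
  then show ?thesis by (simp add: dist_power2_X[OF assms(1)])
qed

lemma mem_ball_X:
  assumes "grad g z \<noteq> 0" "0 < t"
  shows "y \<in> ball (X g z t) t \<longleftrightarrow> (norm (y - z))\<^sup>2 < 2 * t * ((y - z) \<bullet> dir g z)"
proof -
  have "y \<in> ball (X g z t) t \<longleftrightarrow> (dist (X g z t) y)\<^sup>2 < t\<^sup>2"
    using assms(2) by (auto intro: power_strict_mono dest: power_less_imp_less_base)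
  then show ?thesis by (simp add: dist_power2_X[OF assms(1)])
qed

lemma self_mem_cball_X: "grad g z \<noteq> 0 \<Longrightarrow> 0 \<le> t \<Longrightarrow> z \<in> cball (X g z t) t"
  by (simp add: dist_X_base)

lemma inner_dir_pos:
  assumes "grad g z \<noteq> 0" "0 \<le> t" "y \<in> cball (X g z t) t" "y \<noteq> z"
  shows "0 < (y - z) \<bullet> dir g z"
proof -
  have "0 < (norm (y - z))\<^sup>2" using assms(4) by simp
  also have "\<dots> \<le> 2 * t * ((y - z) \<bullet> dir g z)"
    using mem_cball_X[OF assms(1,2)] assms(3) by blast
  finally show ?thesis using assms(2) by (simp add: zero_less_mult_iff)
qed

text \<open>The balls of one ray touch each other internally at \<open>z\<close>.\<close>

lemma cball_X_subset_ball:
  assumes "grad g z \<noteq> 0" "0 \<le> s" "s < t" "y \<in> cball (X g z s) s" "y \<noteq> z"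
  shows "y \<in> ball (X g z t) t"
proof -
  have "(norm (y - z))\<^sup>2 \<le> 2 * s * ((y - z) \<bullet> dir g z)"
    using mem_cball_X[OF assms(1,2)] assms(4) by blast
  also have "\<dots> < 2 * t * ((y - z) \<bullet> dir g z)"
    using inner_dir_pos[OF assms(1,2,4,5)] assms(3) by simp
  finally show ?thesis using assms by (simp add: mem_ball_X del: mem_ball)
qed

lemma cball_X_mono:
  assumes "grad g z \<noteq> 0" "s \<le> t"
  shows "cball (X g z s) s \<subseteq> cball (X g z t) t"
proof
  fix y assume y: "y \<in> cball (X g z s) s"
  then have s: "0 \<le> s" by (meson dual_order.trans mem_cball zero_le_dist)
  show "y \<in> cball (X g z t) t"
  proof (cases "y = z \<or> s = t")
    case True
    then show ?thesis using assms s y self_mem_cball_X[of g z t] by auto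
  next
    case False
    then have "y \<in> ball (X g z t) t"
      using assms y s by (intro cball_X_subset_ball[of g z s]) auto
    then show ?thesis by simp
  qed
qed

lemma ray_min_mono: "grad g z \<noteq> 0 \<Longrightarrow> s \<le> t \<Longrightarrow> ray_min g z t \<Longrightarrow> ray_min g z s"
  unfolding ray_min_def using cball_X_mono by blast

lemma ray_strict_min_mono:
  "grad g z \<noteq> 0 \<Longrightarrow> s \<le> t \<Longrightarrow> ray_strict_min g z t \<Longrightarrow> ray_strict_min g z s"
  unfolding ray_strict_min_def using cball_X_mono by blast

lemma ray_strict_min_imp_min: "ray_strict_min g z t \<Longrightarrow> ray_min g z t"
  unfolding ray_min_def ray_strict_min_def by (metis less_eq_real_def)

lemma ray_min_nonpos: "t \<le> 0 \<Longrightarrow> ray_min g z t"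
  by (auto simp: ray_min_def X_eq) (metis add.right_neutral antisym dist_le_zero_iff dist_self
      dual_order.trans order_refl scale_zero_left zero_le_dist)

section \<open>Continuously differentiable functions and their minimizers on balls\<close>

lemma C1_GDERIV:
  assumes "C1 g" shows "GDERIV g y :> grad g y"
proof -
  have "g differentiable (at y)" using assms by (simp add: C1_def)
  then obtain f where f: "(g has_derivative f) (at y)" unfolding differentiable_def by blast
  interpret f: bounded_linear f using f by (rule has_derivative_bounded_linear)
  define d where "d = (\<Sum>b\<in>Basis. f b *\<^sub>R b)"
  have "f h = h \<bullet> d" for h
  proof -
    have "f h = f (\<Sum>b\<in>Basis. (h \<bullet> b) *\<^sub>R b)" by (simp add: euclidean_representation)
    also have "\<dots> = (\<Sum>b\<in>Basis. (h \<bullet> b) * f b)" by (simp add: f.sum f.scaleR)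
    also have "\<dots> = h \<bullet> d" by (simp add: d_def inner_sum_right mult.commute)
    finally show ?thesis .
  qed
  then have "f = (\<lambda>h. h \<bullet> d)" by blast
  with f have "GDERIV g y :> d" by (simp add: gderiv_def)
  with grad_eqI show ?thesis by metis
qed

lemma C1_has_derivative:
  "C1 g \<Longrightarrow> (g has_derivative (\<lambda>h. h \<bullet> grad g y)) (at y)"
  using C1_GDERIV by (auto simp: gderiv_def)

lemma C1_continuous: "C1 g \<Longrightarrow> continuous_on UNIV g"
  by (meson C1_has_derivative continuous_at_imp_continuous_on has_derivative_continuous)

lemma C1_tendsto: "C1 g \<Longrightarrow> (f \<longlongrightarrow> y) net \<Longrightarrow> ((\<lambda>k. g (f k)) \<longlongrightarrow> g y) net"
  using C1_continuous[of g] continuous_on_eq_continuous_at[of UNIV g]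
  by (auto intro: isCont_tendsto_compose)

lemma C1_tendsto_grad: "C1 g \<Longrightarrow> (f \<longlongrightarrow> y) net \<Longrightarrow> ((\<lambda>k. grad g (f k)) \<longlongrightarrow> grad g y) net"
  using continuous_on_eq_continuous_at[of UNIV "grad g"]
  by (auto simp: C1_def intro: isCont_tendsto_compose)

lemma C1_mvt:
  assumes "C1 g"
  obtains \<theta> where "0 \<le> \<theta>" "\<theta> \<le> 1" "g (y + h) - g y = h \<bullet> grad g (y + \<theta> *\<^sub>R h)"
proof -
  have "\<exists>\<theta>\<in>{0..1}. g (y + 1 *\<^sub>R h) - g (y + 0 *\<^sub>R h) = (1 - 0) *\<^sub>R h \<bullet> grad g (y + \<theta> *\<^sub>R h)"
  proof (rule mvt_very_simple)
    fix s :: real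
    have "((\<lambda>s. g (y + s *\<^sub>R h)) has_derivative (\<lambda>r. r *\<^sub>R h \<bullet> grad g (y + s *\<^sub>R h))) (at s)"
      by (rule has_derivative_compose[OF _ C1_has_derivative[OF assms], of "\<lambda>s. y + s *\<^sub>R h" "\<lambda>r. r *\<^sub>R h"])
        (auto intro!: derivative_eq_intros)
    then show "((\<lambda>s. g (y + s *\<^sub>R h)) has_derivative (\<lambda>r. r *\<^sub>R h \<bullet> grad g (y + s *\<^sub>R h)))
      (at s within {0..1})" by (rule has_derivative_at_withinI)
  qed simp
  then show ?thesis using that by auto
qed

lemma X_tendsto:
  assumes "C1 g" "grad g z \<noteq> 0" "(f \<longlongrightarrow> z) net" "(s \<longlongrightarrow> t) net"
  shows "((\<lambda>k. X g (f k) (s k)) \<longlongrightarrow> X g z t) net"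
  unfolding X_def by (intro tendsto_intros assms C1_tendsto_grad) (use assms in auto)

lemma dir_tendsto:
  assumes "C1 g" "grad g z \<noteq> 0" "(f \<longlongrightarrow> z) net"
  shows "((\<lambda>k. dir g (f k)) \<longlongrightarrow> dir g z) net"
  unfolding dir_def by (intro tendsto_intros assms C1_tendsto_grad) (use assms in auto)

lemma minimizer_iff:
  assumes "C1 g"
  shows "minimizer g x t y \<longleftrightarrow> y \<in> cball x t \<and> (\<forall>z\<in>cball x t. g y \<le> g z)"
proof -
  have *: "norm (y - x) \<le> t \<longleftrightarrow> y \<in> cball x t" by (simp add: dist_norm norm_minus_commute)
  show ?thesis
  proof (cases "0 \<le> t")
    case True
    with u_attained[OF C1_continuous[OF assms], of t x] show ?thesis
      unfolding minimizer_def * by (metis order_antisym)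
  next
    case False
    then show ?thesis by (auto simp: minimizer_def) (smt (verit) norm_ge_zero)
  qed
qed

lemma minimizer_exists:
  assumes "C1 g" "0 \<le> t" shows "\<exists>y. minimizer g x t y"
  using u_attained[OF C1_continuous[OF assms(1)] assms(2)] minimizer_iff[OF assms(1)] by metis

lemma minimizer_ray_iff:
  assumes "C1 g" "grad g z \<noteq> 0" "0 \<le> t"
  shows "minimizer g (X g z t) t z \<longleftrightarrow> ray_min g z t"
  using self_mem_cball_X[OF assms(2,3)] by (auto simp: minimizer_iff[OF assms(1)] ray_min_def)

lemma unique_minimizer_ray_iff:
  assumes "C1 g" "grad g z \<noteq> 0" "0 \<le> t"
  shows "minimizer g (X g z t) t z \<and> (\<forall>y. minimizer g (X g z t) t y \<longrightarrow> y = z)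
    \<longleftrightarrow> ray_strict_min g z t" (is "?l \<longleftrightarrow> ?r")
proof
  assume l: ?l
  show ?r unfolding ray_strict_min_def
  proof (intro ballI impI)
    fix y assume y: "y \<in> cball (X g z t) t" "y \<noteq> z"
    have "\<forall>w\<in>cball (X g z t) t. g z \<le> g w" using l minimizer_iff[OF assms(1)] by blast
    moreover have "g y \<noteq> g z"
      using l y calculation minimizer_iff[OF assms(1)] by metis
    ultimately show "g z < g y" using y by force
  qed
next
  assume r: ?r
  then have m: "ray_min g z t" by (rule ray_strict_min_imp_min)
  show ?l
  proof (intro conjI allI impI)
    show "minimizer g (X g z t) t z" using m minimizer_ray_iff[OF assms] by blast
    fix y assume "minimizer g (X g z t) t y"
    then have "y \<in> cball (X g z t) t" "g y \<le> g z"
      using self_mem_cball_X[OF assms(2,3)] by (auto simp: minimizer_iff[OF assms(1)] simp del: mem_cball)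
    then show "y = z" using r unfolding ray_strict_min_def by force
  qed
qed

text \<open>The point \<open>p = x - t n\<close>, with \<open>n\<close> the direction of the gradient at \<open>y\<close>, is where the linear
  form \<open>grad g y\<close> is smallest on the ball. Moving from the minimizer \<open>y\<close> towards \<open>p\<close> cannot
  decrease \<open>g\<close> to first order, so \<open>y = p\<close>.\<close>

lemma minimizer_on_ray:
  assumes g: "C1 g" and min: "minimizer g x t y" and nz: "grad g y \<noteq> 0"
  shows "x = X g y t"
proof -
  define n where "n = dir g y"
  define p where "p = x - t *\<^sub>R n"
  have y: "y \<in> cball x t" and le: "\<And>w. w \<in> cball x t \<Longrightarrow> g y \<le> g w"
    using min by (auto simp: minimizer_iff[OF g] simp del: mem_cball)
  have t: "0 \<le> t" using y by (meson dual_order.trans mem_cball zero_le_dist)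
  have n1: "norm n = 1" using norm_dir[OF nz] by (simp add: n_def)
  have p: "p \<in> cball x t" using t n1 by (simp add: p_def dist_norm)
  have D: "((\<lambda>s. g (y + s *\<^sub>R (p - y))) has_real_derivative (p - y) \<bullet> grad g y) (at 0)"
  proof -
    have "((\<lambda>s. g (y + s *\<^sub>R (p - y))) has_derivative (\<lambda>r. r *\<^sub>R (p - y) \<bullet> grad g y)) (at 0)"
      by (rule has_derivative_compose[of "\<lambda>s. y + s *\<^sub>R (p - y)" "\<lambda>r. r *\<^sub>R (p - y)"])
        (use C1_has_derivative[OF g, of y] in \<open>auto intro!: derivative_eq_intros\<close>)
    then show ?thesis by (simp add: has_field_derivative_def mult_commute_abs)
  qed
  have "0 \<le> (p - y) \<bullet> grad g y"
  proof (rule ccontr)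
    assume "\<not> 0 \<le> (p - y) \<bullet> grad g y"
    then obtain d where d: "d > 0" "\<And>h. 0 < h \<Longrightarrow> h < d \<Longrightarrow> g (y + h *\<^sub>R (p - y)) < g (y + 0 *\<^sub>R (p - y))"
      using DERIV_neg_dec_right[OF D] by auto
    define h where "h = min (d / 2) 1"
    have h: "0 < h" "h < d" "h \<le> 1" using d(1) by (auto simp: h_def)
    have "y + h *\<^sub>R (p - y) = (1 - h) *\<^sub>R y + h *\<^sub>R p" by (simp add: algebra_simps)
    also have "\<dots> \<in> cball x t" using h by (intro convexD_alt[OF convex_cball] y p) auto
    finally have "g y \<le> g (y + h *\<^sub>R (p - y))" by (rule le)
    with d(2)[OF h(1,2)] show False by simp
  qed
  then have "0 \<le> norm (grad g y) * ((p - y) \<bullet> n)"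
    unfolding n_def inner_grad_eq_dir .
  then have "0 \<le> (p - y) \<bullet> n" using nz by (simp add: zero_le_mult_iff)
  moreover have nn: "n \<bullet> n = 1" using n1 by (simp add: norm_eq_1)
  ultimately have 1: "t \<le> (x - y) \<bullet> n" by (simp add: p_def inner_diff_left)
  have "(norm (x - y - t *\<^sub>R n))\<^sup>2 = (norm (x - y))\<^sup>2 - 2 * t * ((x - y) \<bullet> n) + t\<^sup>2"
    unfolding power2_norm_eq_inner
    by (simp only: inner_diff_left[of "x - y"] inner_diff_right[of _ "x - y"])
      (simp add: nn power2_eq_square inner_commute algebra_simps)
  also have "\<dots> \<le> t\<^sup>2 - 2 * t * t + t\<^sup>2"
  proof -
    have "(norm (x - y))\<^sup>2 \<le> t\<^sup>2" using y t by (auto simp: dist_norm)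
    moreover have "2 * t * t \<le> 2 * t * ((x - y) \<bullet> n)" using t 1 by (intro mult_left_mono) auto
    ultimately show ?thesis by simp
  qed
  also have "\<dots> = 0" by (simp add: power2_eq_square)
  finally have "x - y - t *\<^sub>R n = 0" by simp
  then show ?thesis by (simp add: X_eq n_def algebra_simps)
qed

lemma minimizer_ray_min:
  assumes g: "C1 g" and min: "minimizer g x t y" and nz: "grad g y \<noteq> 0"
  shows "ray_min g y t"
  using assms minimizer_on_ray[OF assms] by (simp add: minimizer_iff ray_min_def)

section \<open>Stability of minimizers\<close>

lemma shifted_mem_cball:
  fixes x x' y :: "real^'n"
  assumes "0 < t" "y \<in> cball x t" "0 \<le> t'"
  shows "x' + (t' / t) *\<^sub>R (y - x) \<in> cball x' t'"
proof -
  have "norm (y - x) \<le> t" using assms(2) by (simp add: dist_norm norm_minus_commute)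
  then have "\<bar>t' / t\<bar> * norm (y - x) \<le> \<bar>t' / t\<bar> * t" using assms(1,3) by (intro mult_left_mono) auto
  also have "\<dots> = t'" using assms(1,3) by simp
  finally have "norm ((t' / t) *\<^sub>R (y - x)) \<le> t'" unfolding norm_scaleR .
  then show ?thesis unfolding mem_cball dist_norm by (metis add_diff_cancel_left' norm_minus_commute)
qed

text \<open>The balls at nearby points are translated and scaled copies of each other, so each competitor
  in the limit ball is a limit of competitors in the approximating ones.\<close>

lemma minimizer_limit:
  assumes g: "C1 g" and t: "0 < t" and xs: "xs \<longlonglongrightarrow> x" and rs: "rs \<longlonglongrightarrow> t"
    and min: "\<And>k. minimizer g (xs k) (rs k) (ys k)"
  obtains \<sigma> y where "strict_mono \<sigma>" "minimizer g x t y" "(\<lambda>k. ys (\<sigma> k)) \<longlonglongrightarrow> y"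
proof -
  have in_ball: "dist (xs k) (ys k) \<le> rs k" and le: "\<And>w. w \<in> cball (xs k) (rs k) \<Longrightarrow> g (ys k) \<le> g w" for k
    using min[of k] by (auto simp: minimizer_iff[OF g])
  have "(\<lambda>k. norm (xs k) + rs k) \<longlonglongrightarrow> norm x + t" by (intro tendsto_intros xs rs)
  then have "Bseq (\<lambda>k. norm (xs k) + rs k)" by (intro convergent_imp_Bseq convergentI)
  then obtain K where K: "\<And>k. norm (norm (xs k) + rs k) \<le> K" unfolding Bseq_def by blast
  have "ys k \<in> cball 0 K" for k
    using in_ball[of k] K[of k] norm_triangle_sub[of "ys k" "xs k"]
    by (simp add: dist_norm norm_minus_commute)
  moreover have "seq_compact (cball (0::real^'a) K)" by (simp add: compact_imp_seq_compact)
  ultimately obtain y \<sigma> where \<sigma>: "strict_mono \<sigma>" "(ys \<circ> \<sigma>) \<longlonglongrightarrow> y"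
    unfolding seq_compact_def by meson
  have ys: "(\<lambda>k. ys (\<sigma> k)) \<longlonglongrightarrow> y" using \<sigma>(2) by (simp add: o_def)
  have xs': "(\<lambda>k. xs (\<sigma> k)) \<longlonglongrightarrow> x" using LIMSEQ_subseq_LIMSEQ[OF xs \<sigma>(1)] by (simp add: o_def)
  have rs': "(\<lambda>k. rs (\<sigma> k)) \<longlonglongrightarrow> t" using LIMSEQ_subseq_LIMSEQ[OF rs \<sigma>(1)] by (simp add: o_def)
  have "minimizer g x t y" unfolding minimizer_iff[OF g]
  proof (intro conjI ballI)
    have "dist x y \<le> t"
      by (rule tendsto_le[OF sequentially_bot rs' tendsto_dist[OF xs' ys]]) (simp add: in_ball)
    then show "y \<in> cball x t" by simp
    fix w assume w: "w \<in> cball x t"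
    define v where "v k = xs (\<sigma> k) + (rs (\<sigma> k) / t) *\<^sub>R (w - x)" for k
    have "(\<lambda>k. v k) \<longlonglongrightarrow> x + (t / t) *\<^sub>R (w - x)"
      unfolding v_def using t by (intro tendsto_intros xs' rs') simp
    then have v: "v \<longlonglongrightarrow> w" using t by simp
    have vin: "v k \<in> cball (xs (\<sigma> k)) (rs (\<sigma> k))" for k
    proof -
      have "0 \<le> rs (\<sigma> k)" using in_ball by (meson order_trans zero_le_dist)
      then show ?thesis unfolding v_def by (intro shifted_mem_cball[OF t w])
    qed
    show "g y \<le> g w"
      by (rule tendsto_le[OF sequentially_bot C1_tendsto[OF g v] C1_tendsto[OF g ys]])
        (use le vin in auto)
  qed
  with \<sigma>(1) ys show ?thesis using that by blast
qed

lemma minimizers_stable: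
  assumes g: "C1 g" and t: "0 < t" and uni: "\<And>y. minimizer g x t y \<Longrightarrow> y \<in> V" and V: "open V"
  obtains r where "0 < r" "\<And>x' y. dist x' x < r \<Longrightarrow> minimizer g x' t y \<Longrightarrow> y \<in> V"
proof (rule ccontr)
  assume "\<not> thesis"
  with that have "\<forall>k. \<exists>x' y. dist x' x < inverse (Suc k) \<and> minimizer g x' t y \<and> y \<notin> V"
    by (metis inverse_positive_iff_positive of_nat_0_less_iff zero_less_Suc)
  then obtain xs ys where *: "\<And>k. dist (xs k) x < inverse (Suc k)"
    "\<And>k. minimizer g (xs k) t (ys k)" "\<And>k. ys k \<notin> V" by metis
  have "(\<lambda>k. dist (xs k) x) \<longlonglongrightarrow> 0"
    by (rule tendsto_sandwich[OF _ _ tendsto_const LIMSEQ_inverse_real_of_nat])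
      (use *(1) in \<open>auto intro!: always_eventually less_imp_le\<close>)
  then have "xs \<longlonglongrightarrow> x" using tendsto_dist_iff by blast
  from minimizer_limit[OF g t this tendsto_const *(2)] obtain \<sigma> y where
    "minimizer g x t y" and l: "(\<lambda>k. ys (\<sigma> k)) \<longlonglongrightarrow> y" by metis
  then have "y \<in> V" using uni by blast
  then have "\<forall>\<^sub>F k in sequentially. ys (\<sigma> k) \<in> V" using topological_tendstoD[OF l V] by blast
  then show False using *(3) by (simp add: eventually_sequentially)
qed

text \<open>Failure of minimality is an open condition: a competitor with a smaller value can be pushed
  slightly into the interior of the ball.\<close>

lemma not_ray_min_nhds:
  assumes g: "C1 g" and nz: "grad g z \<noteq> 0" and nm: "\<not> ray_min g z t"
  obtains \<delta> where "0 < \<delta>" "\<And>w. dist w z < \<delta> \<Longrightarrow> \<not> ray_min g w t"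
proof -
  have t: "0 < t" using ray_min_nonpos[of t g z] nm by (cases "t \<le> 0") auto
  obtain y where "y \<in> cball (X g z t) t" "\<not> g z \<le> g y"
    using nm unfolding ray_min_def by blast
  then have y: "dist (X g z t) y \<le> t" "g y < g z" by auto
  \<comment> \<open>Moving the competitor \<open>y\<close> towards the centre makes it interior.\<close>
  define p where "p s = y + s *\<^sub>R (X g z t - y)" for s
  have "((\<lambda>s. g (p s)) \<longlongrightarrow> g (p 0)) (at_right 0)"
    unfolding p_def by (intro C1_tendsto[OF g] tendsto_intros)
  then have "\<forall>\<^sub>F s in at_right 0. g (p s) < g z"
    by (rule order_tendstoD(2)) (simp add: p_def y(2))
  moreover have "\<forall>\<^sub>F s in at_right (0::real). s \<in> {0<..<1}"
    by (rule eventually_at_right_real) simp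
  ultimately have "\<forall>\<^sub>F s in at_right 0. g (p s) < g z \<and> 0 < s \<and> s < 1" by eventually_elim auto
  then obtain s where s: "g (p s) < g z" "0 < s" "s < 1"
    using eventually_happens'[OF trivial_limit_at_right_real[of "0::real"]] by blast
  have "X g z t - p s = (1 - s) *\<^sub>R (X g z t - y)"
    by (simp add: p_def scaleR_diff_left scaleR_diff_right)
  then have "dist (X g z t) (p s) = (1 - s) * dist (X g z t) y" using s by (simp add: dist_norm)
  also have "\<dots> \<le> (1 - s) * t" using y s by (intro mult_left_mono) auto
  also have "\<dots> < t" using s t by simp
  finally have ps: "dist (X g z t) (p s) < t" .
  have "((\<lambda>w. X g w t) \<longlongrightarrow> X g z t) (nhds z)"
    by (rule X_tendsto[OF g nz filterlim_ident tendsto_const])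
  then have "((\<lambda>w. dist (X g w t) (p s)) \<longlongrightarrow> dist (X g z t) (p s)) (nhds z)"
    by (intro tendsto_intros)
  then have "\<forall>\<^sub>F w in nhds z. dist (X g w t) (p s) < t" using ps by (rule order_tendstoD)
  moreover have "\<forall>\<^sub>F w in nhds z. g (p s) < g w"
    using order_tendstoD(1)[OF C1_tendsto[OF g filterlim_ident] s(1)] by simp
  ultimately have "\<forall>\<^sub>F w in nhds z. \<not> ray_min g w t"
  proof eventually_elim
    case (elim w)
    then have "p s \<in> cball (X g w t) t" "\<not> g w \<le> g (p s)" by auto
    then show ?case unfolding ray_min_def by blast
  qed
  then show ?thesis using that by (auto simp: eventually_nhds_metric)
qed

section \<open>Differentiability of the Hopf--Lax solution\<close>

text \<open>The derivative at \<open>(x, t)\<close> of the value of \<open>g\<close> at the point that sits in the ball of \<open>(x', t')\<close> as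
  \<open>y\<close> sits in the ball of \<open>(x, t)\<close>.\<close>

definition shift_form :: "(real^'n \<Rightarrow> real) \<Rightarrow> real^'n \<Rightarrow> real \<Rightarrow> real^'n \<Rightarrow> (real^'n) \<times> real \<Rightarrow> real" where
  "shift_form g x t y d = (fst d + (snd d / t) *\<^sub>R (y - x)) \<bullet> grad g y"

lemma shift_form_has_derivative:
  assumes g: "C1 g" and t: "0 < t"
  shows "((\<lambda>(x', t'). g (x' + (t' / t) *\<^sub>R (y - x))) has_derivative shift_form g x t y) (at (x, t))"
proof -
  have 1: "((\<lambda>q. fst q + (snd q / t) *\<^sub>R (y - x)) has_derivative
      (\<lambda>d. fst d + (snd d / t) *\<^sub>R (y - x))) (at (x, t))"
    using t by (auto intro!: derivative_eq_intros)
  have 2: "(g has_derivative (\<lambda>h. h \<bullet> grad g y)) (at (fst (x, t) + (snd (x, t) / t) *\<^sub>R (y - x)))"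
    using C1_has_derivative[OF g, of y] t by simp
  have "((\<lambda>q. g (fst q + (snd q / t) *\<^sub>R (y - x))) has_derivative
      (\<lambda>d. (fst d + (snd d / t) *\<^sub>R (y - x)) \<bullet> grad g y)) (at (x, t))"
    by (rule has_derivative_compose[OF 1 2])
  then show ?thesis unfolding shift_form_def[abs_def] by (simp add: case_prod_unfold)
qed

lemma u_eq_minimizer: "minimizer g x t y \<Longrightarrow> u g x t = g y"
  by (simp add: minimizer_def)

lemma u_le: "C1 g \<Longrightarrow> y \<in> cball x t \<Longrightarrow> u g x t \<le> g y"
  (is "_ \<Longrightarrow> ?y \<Longrightarrow> _")
proof -
  assume g: "C1 g" and y: ?y
  then have "0 \<le> t" by (meson dual_order.trans mem_cball zero_le_dist)
  then obtain z where "minimizer g x t z" using minimizer_exists[OF g] by blast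
  then show ?thesis using y by (auto simp: u_eq_minimizer minimizer_iff[OF g] simp del: mem_cball)
qed

text \<open>Carrying a minimizer \<open>y\<close> of \<open>(x, t)\<close> along by translation and scaling of the ball shows that
  \<open>u\<close> is bounded above near \<open>(x, t)\<close> by a differentiable function touching it at \<open>(x, t)\<close>, whose
  derivative is \<open>shift_form g x t y\<close>. Carrying minimizers of nearby points back gives the matching
  lower bound, because they accumulate only at minimizers of \<open>(x, t)\<close>.\<close>

lemma u_differentiable:
  fixes g :: "real^'n \<Rightarrow> real"
  assumes g: "C1 g" and t: "0 < t" and L: "\<And>y. minimizer g x t y \<Longrightarrow> shift_form g x t y = L"
  shows "(\<lambda>(x, t). u g x t) differentiable (at (x, t))"
proof -
  obtain y0 where y0: "minimizer g x t y0" using minimizer_exists[OF g] t by (meson less_imp_le)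
  have bl: "bounded_linear L"
    using shift_form_has_derivative[OF g t, of y0 x] L[OF y0] has_derivative_bounded_linear by metis
  define U where "U q = u g (fst q) (snd q)" for q
  have "(U has_derivative L) (at (x, t))" unfolding has_derivative_at_alt
  proof (intro conjI bl allI impI)
    fix e :: real assume e: "0 < e"
    obtain d1 where d1: "d1 > 0" and
      "\<And>q. norm (q - (x, t)) < d1 \<Longrightarrow> norm ((case q of (x', t') \<Rightarrow> g (x' + (t' / t) *\<^sub>R (y0 - x)))
         - (case (x, t) of (x', t') \<Rightarrow> g (x' + (t' / t) *\<^sub>R (y0 - x))) - L (q - (x, t))) \<le> e * norm (q - (x, t))"
      using shift_form_has_derivative[OF g t, of y0 x] e unfolding L[OF y0] has_derivative_at_alt by metis
    then have d1': "g (x' + (t' / t) *\<^sub>R (y0 - x)) - g y0 - L ((x', t') - (x, t)) \<le> e * norm ((x', t') - (x, t))"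
      if "norm ((x', t') - (x, t)) < d1" for x' t' using that t by fastforce
    have upper: "U q - U (x, t) - L (q - (x, t)) \<le> e * norm (q - (x, t))"
      if q: "norm (q - (x, t)) < min d1 t" for q
    proof -
      obtain x' t' where q': "q = (x', t')" by force
      have "\<bar>t' - t\<bar> < t" using q norm_snd_le[of "t' - t" "x' - x"] by (auto simp: q')
      then have "x' + (t' / t) *\<^sub>R (y0 - x) \<in> cball x' t'"
        using y0 t by (intro shifted_mem_cball) (auto simp: minimizer_iff[OF g])
      then have "U q \<le> g (x' + (t' / t) *\<^sub>R (y0 - x))" using u_le[OF g] by (simp add: U_def q')
      moreover have "U (x, t) = g y0" using u_eq_minimizer[OF y0] by (simp add: U_def)
      ultimately show ?thesis using d1'[of x' t'] q by (auto simp: q')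
    qed
    have "\<exists>d2>0. \<forall>q. norm (q - (x, t)) < d2 \<longrightarrow> - (e * norm (q - (x, t))) \<le> U q - U (x, t) - L (q - (x, t))"
    proof (rule ccontr)
      assume "\<not> ?thesis"
      then have "\<forall>k. \<exists>q. norm (q - (x, t)) < min t (inverse (Suc k)) \<and>
          U q - U (x, t) - L (q - (x, t)) < - (e * norm (q - (x, t)))"
        using t by (metis (no_types) inverse_positive_iff_positive min_less_iff_conj not_le of_nat_0_less_iff zero_less_Suc)
      then obtain qs where qs: "\<And>k. norm (qs k - (x, t)) < min t (inverse (Suc k))"
        "\<And>k. U (qs k) - U (x, t) - L (qs k - (x, t)) < - (e * norm (qs k - (x, t)))" by metis
      define xs where "xs k = fst (qs k)" for k
      define rs where "rs k = snd (qs k)" for k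
      have "(\<lambda>k. dist (qs k) (x, t)) \<longlonglongrightarrow> 0"
        by (rule tendsto_sandwich[OF _ _ tendsto_const LIMSEQ_inverse_real_of_nat])
          (use qs(1) in \<open>auto intro!: always_eventually less_imp_le simp: dist_norm\<close>)
      then have "qs \<longlonglongrightarrow> (x, t)" using tendsto_dist_iff by blast
      then have xs: "xs \<longlonglongrightarrow> x" and rs: "rs \<longlonglongrightarrow> t"
        unfolding xs_def rs_def by (auto dest: tendsto_fst tendsto_snd)
      have rs0: "0 < rs k" for k
      proof -
        have "\<bar>rs k - t\<bar> \<le> norm (qs k - (x, t))"
          using norm_snd_le[of "rs k - t" "xs k - x"] by (simp add: xs_def rs_def norm_prod_def)
        then show ?thesis using qs(1)[of k] by auto
      qed
      have "\<exists>y. minimizer g (xs k) (rs k) y" for k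
        using minimizer_exists[OF g] rs0[of k] by (meson less_imp_le)
      then obtain ys where ys: "\<And>k. minimizer g (xs k) (rs k) (ys k)" by metis
      obtain \<sigma> y where \<sigma>: "strict_mono \<sigma>" and y: "minimizer g x t y" and lim: "(\<lambda>k. ys (\<sigma> k)) \<longlonglongrightarrow> y"
        using minimizer_limit[OF g t xs rs ys] by metis
      have xs': "(\<lambda>k. xs (\<sigma> k)) \<longlonglongrightarrow> x" using LIMSEQ_subseq_LIMSEQ[OF xs \<sigma>(1)] by (simp add: o_def)
      have rs': "(\<lambda>k. rs (\<sigma> k)) \<longlonglongrightarrow> t" using LIMSEQ_subseq_LIMSEQ[OF rs \<sigma>(1)] by (simp add: o_def)
      \<comment> \<open>The minimizer \<open>ys k\<close> is carried back to \<open>w k\<close> in the ball of \<open>(x, t)\<close>; the displacement \<open>h k\<close>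
        is approximately the argument of the gradient in \<open>shift_form g x t y\<close>.\<close>
      define v where "v k = (1 / rs k) *\<^sub>R (ys k - xs k)" for k
      define w where "w k = x + (t / rs k) *\<^sub>R (ys k - xs k)" for k
      define h where "h k = (xs k - x) + (rs k - t) *\<^sub>R v k" for k
      have wh: "w k + h k = ys k" for k
        using rs0[of k] unfolding w_def h_def v_def
        by (simp add: algebra_simps) (simp add: diff_divide_distrib flip: scaleR_add_left scaleR_diff_left)
      have "\<forall>k. \<exists>\<theta>. 0 \<le> \<theta> \<and> \<theta> \<le> 1 \<and> g (w k + h k) - g (w k) = h k \<bullet> grad g (w k + \<theta> *\<^sub>R h k)"
        using C1_mvt[OF g] by metis
      then obtain \<theta> where \<theta>: "\<And>k. 0 \<le> \<theta> k" "\<And>k. \<theta> k \<le> 1"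
        "\<And>k. g (w k + h k) - g (w k) = h k \<bullet> grad g (w k + \<theta> k *\<^sub>R h k)" by metis
      define \<xi> where "\<xi> k = w k + \<theta> k *\<^sub>R h k" for k
      have v': "(\<lambda>k. v (\<sigma> k)) \<longlonglongrightarrow> (1 / t) *\<^sub>R (y - x)"
        unfolding v_def using t by (intro tendsto_intros lim xs' rs') simp
      have "(\<lambda>k. h (\<sigma> k)) \<longlonglongrightarrow> (x - x) + (t - t) *\<^sub>R ((1 / t) *\<^sub>R (y - x))"
        unfolding h_def by (intro tendsto_intros xs' rs' v')
      then have h': "(\<lambda>k. h (\<sigma> k)) \<longlonglongrightarrow> 0" by simp
      have w': "(\<lambda>k. w (\<sigma> k)) \<longlonglongrightarrow> y"
      proof -
        have "(\<lambda>k. ys (\<sigma> k) - h (\<sigma> k)) \<longlonglongrightarrow> y - 0" by (intro tendsto_intros lim h')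
        moreover have "ys k - h k = w k" for k using wh[of k] by (simp add: algebra_simps)
        ultimately show ?thesis by simp
      qed
      have "(\<lambda>k. \<theta> (\<sigma> k) *\<^sub>R h (\<sigma> k)) \<longlonglongrightarrow> 0"
      proof (rule Lim_null_comparison)
        show "\<forall>\<^sub>F k in sequentially. norm (\<theta> (\<sigma> k) *\<^sub>R h (\<sigma> k)) \<le> norm (h (\<sigma> k))"
          using \<theta>(1,2) by (intro always_eventually) (auto intro!: mult_left_le_one_le)
        show "(\<lambda>k. norm (h (\<sigma> k))) \<longlonglongrightarrow> 0" using tendsto_norm[OF h'] by simp
      qed
      then have "(\<lambda>k. w (\<sigma> k) + \<theta> (\<sigma> k) *\<^sub>R h (\<sigma> k)) \<longlonglongrightarrow> y + 0" by (intro tendsto_intros w')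
      then have \<xi>': "(\<lambda>k. \<xi> (\<sigma> k)) \<longlonglongrightarrow> y" by (simp add: \<xi>_def)
      \<comment> \<open>The relative error of replacing \<open>h k \<bullet> grad g (\<xi> k)\<close> by the value of \<open>L\<close>.\<close>
      define \<epsilon> where "\<epsilon> k = norm (grad g (\<xi> k) - grad g y) +
        \<bar>v k \<bullet> grad g (\<xi> k) - ((1 / t) *\<^sub>R (y - x)) \<bullet> grad g y\<bar>" for k
      have "(\<lambda>k. \<epsilon> (\<sigma> k)) \<longlonglongrightarrow> norm (grad g y - grad g y) +
        \<bar>((1 / t) *\<^sub>R (y - x)) \<bullet> grad g y - ((1 / t) *\<^sub>R (y - x)) \<bullet> grad g y\<bar>"
        unfolding \<epsilon>_def by (intro tendsto_intros v' C1_tendsto_grad[OF g] \<xi>')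
      then have "\<forall>\<^sub>F k in sequentially. \<epsilon> (\<sigma> k) < e" using e by (intro order_tendstoD) auto
      then obtain j where "\<epsilon> (\<sigma> j) < e" by (metis eventually_happens' sequentially_bot)
      then obtain k where k: "\<epsilon> k < e" by blast
      define dx where "dx = xs k - x"
      define dt where "dt = rs k - t"
      have d: "qs k - (x, t) = (dx, dt)" by (simp add: dx_def dt_def xs_def rs_def prod_eq_iff)
      have "w k \<in> cball x t" unfolding w_def
        using ys[of k] rs0[of k] t by (intro shifted_mem_cball) (auto simp: minimizer_iff[OF g])
      then have "U (x, t) \<le> g (w k)" using u_le[OF g] by (simp add: U_def)
      moreover have "U (qs k) = g (ys k)" using u_eq_minimizer[OF ys[of k]] by (simp add: U_def xs_def rs_def)
      ultimately have "h k \<bullet> grad g (\<xi> k) \<le> U (qs k) - U (x, t)" using \<theta>(3)[of k] wh[of k] by (simp add: \<xi>_def)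
      moreover have "L (dx, dt) - h k \<bullet> grad g (\<xi> k) \<le> \<epsilon> k * norm (dx, dt)"
      proof -
        have "L (dx, dt) - h k \<bullet> grad g (\<xi> k) = - (dx \<bullet> (grad g (\<xi> k) - grad g y)) -
           dt * (v k \<bullet> grad g (\<xi> k) - ((1 / t) *\<^sub>R (y - x)) \<bullet> grad g y)"
          unfolding L[OF y, symmetric] shift_form_def h_def dx_def[symmetric] dt_def[symmetric]
          by (simp add: algebra_simps inner_add_left inner_diff_right)
        also have "\<dots> \<le> norm dx * norm (grad g (\<xi> k) - grad g y) +
           \<bar>dt\<bar> * \<bar>v k \<bullet> grad g (\<xi> k) - ((1 / t) *\<^sub>R (y - x)) \<bullet> grad g y\<bar>"
          using Cauchy_Schwarz_ineq2[of dx "grad g (\<xi> k) - grad g y"] by (simp flip: abs_mult)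
        also have "\<dots> \<le> norm (dx, dt) * norm (grad g (\<xi> k) - grad g y) +
           norm (dx, dt) * \<bar>v k \<bullet> grad g (\<xi> k) - ((1 / t) *\<^sub>R (y - x)) \<bullet> grad g y\<bar>"
          using norm_fst_le[of dx dt] norm_snd_le[of dt dx] by (intro add_mono mult_right_mono) auto
        finally show ?thesis by (simp add: \<epsilon>_def algebra_simps)
      qed
      moreover have "\<epsilon> k * norm (dx, dt) \<le> e * norm (dx, dt)" using k by (intro mult_right_mono) auto
      ultimately show False using qs(2)[of k] unfolding d by linarith
    qed
    then obtain d2 where d2: "d2 > 0" "\<And>q. norm (q - (x, t)) < d2 \<Longrightarrow>
      - (e * norm (q - (x, t))) \<le> U q - U (x, t) - L (q - (x, t))" by blast
    show "\<exists>d>0. \<forall>q. norm (q - (x, t)) < d \<longrightarrow> norm (U q - U (x, t) - L (q - (x, t))) \<le> e * norm (q - (x, t))"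
    proof (intro exI conjI allI impI)
      show "0 < min (min d1 t) d2" using d1 d2(1) t by simp
      fix q assume q: "norm (q - (x, t)) < min (min d1 t) d2"
      have "U q - U (x, t) - L (q - (x, t)) \<le> e * norm (q - (x, t))"
        using q by (intro upper) simp
      moreover have "- (e * norm (q - (x, t))) \<le> U q - U (x, t) - L (q - (x, t))"
        using q by (intro d2(2)) simp
      ultimately show "norm (U q - U (x, t) - L (q - (x, t))) \<le> e * norm (q - (x, t))"
        unfolding real_norm_def by (simp add: abs_le_iff)
    qed
  qed
  moreover have "(\<lambda>(x, t). u g x t) = U" by (auto simp: U_def)
  ultimately show ?thesis unfolding differentiable_def by metis
qed

text \<open>Translating a minimizer touches \<open>u\<close> from above, so a spatial derivative of \<open>u\<close> must coincide
  with the gradient of \<open>g\<close> there.\<close>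

lemma u_derivative_at_minimizer:
  assumes g: "C1 g" and D: "((\<lambda>(x, t). u g x t) has_derivative D) (at (x, t))" and y: "minimizer g x t y"
  shows "D (h, 0) = h \<bullet> grad g y"
proof -
  have "((\<lambda>h. (x + h, t)) has_derivative (\<lambda>h. (0 + h, 0))) (at 0)"
    by (intro has_derivative_Pair has_derivative_add has_derivative_const has_derivative_ident)
  moreover have "((\<lambda>(x, t). u g x t) has_derivative D) (at (x + 0, t))" using D by simp
  ultimately have "((\<lambda>h. case (x + h, t) of (x, t) \<Rightarrow> u g x t) has_derivative (\<lambda>h. D (0 + h, 0))) (at 0)"
    by (rule has_derivative_compose)
  then have "((\<lambda>h. u g (x + h) t) has_derivative (\<lambda>h. D (h, 0))) (at 0)" by simp
  moreover have "((\<lambda>h. g (y + h)) has_derivative (\<lambda>h. h \<bullet> grad g y)) (at 0)"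
  proof -
    have "((\<lambda>h. y + h) has_derivative (\<lambda>h. 0 + h)) (at 0)"
      by (intro has_derivative_add has_derivative_const has_derivative_ident)
    moreover have "(g has_derivative (\<lambda>h. h \<bullet> grad g y)) (at (y + 0))"
      using C1_has_derivative[OF g, of y] by simp
    ultimately have "((\<lambda>h. g (y + h)) has_derivative (\<lambda>h. (0 + h) \<bullet> grad g y)) (at 0)"
      by (rule has_derivative_compose)
    then show ?thesis by simp
  qed
  ultimately have d: "((\<lambda>h. u g (x + h) t - g (y + h)) has_derivative (\<lambda>h. D (h, 0) - h \<bullet> grad g y)) (at 0)"
    by (rule has_derivative_diff)
  have le: "u g (x + h) t - g (y + h) \<le> u g (x + 0) t - g (y + 0)" for h
  proof -
    have "y + h \<in> cball (x + h) t" using y by (auto simp: minimizer_iff[OF g])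
    then show ?thesis using u_le[OF g] u_eq_minimizer[OF y] by simp
  qed
  have "(\<lambda>h. D (h, 0) - h \<bullet> grad g y) = (\<lambda>h. 0)"
  proof (rule differential_zero_maxmin[OF UNIV_I open_UNIV d])
    show "(\<forall>h\<in>UNIV. u g (x + h) t - g (y + h) \<le> u g (x + 0) t - g (y + 0)) \<or>
       (\<forall>h\<in>UNIV. u g (x + 0) t - g (y + 0) \<le> u g (x + h) t - g (y + h))" using le by blast
  qed
  from fun_cong[OF this, of h] show ?thesis by simp
qed

lemma grad_eq_of_differentiable:
  assumes g: "C1 g" and D: "(\<lambda>(x, t). u g x t) differentiable (at (x, t))"
    and "minimizer g x t y" "minimizer g x t y'"
  shows "grad g y = grad g y'"
proof -
  obtain D where "((\<lambda>(x, t). u g x t) has_derivative D) (at (x, t))" using D unfolding differentiable_def by blast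
  then have "h \<bullet> grad g y = h \<bullet> grad g y'" for h
    using u_derivative_at_minimizer[OF g _ assms(3), of D h]
      u_derivative_at_minimizer[OF g _ assms(4), of D h] by simp
  then show ?thesis using vector_eq_ldot[of "grad g y" "grad g y'"] by simp
qed

section \<open>The set \<open>T (M g)\<close> consists of the singular points and \<open>T1 g\<close>\<close>

lemma ray_strict_min_nonpos: "t \<le> 0 \<Longrightarrow> ray_strict_min g z t"
  unfolding ray_strict_min_def
proof (intro ballI impI)
  fix y assume t: "t \<le> 0" and y: "y \<in> cball (X g z t) t" "y \<noteq> z"
  have "0 \<le> t" using y(1) by (meson dual_order.trans mem_cball zero_le_dist)
  with t y show "g z < g y" by (simp add: X_eq)
qed

text \<open>Scaling about \<open>z\<close> carries a competitor in the ball at time \<open>t\<close> to competitors at earlier times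
  that converge to it.\<close>

lemma ray_min_left_limit:
  assumes g: "C1 g" and le: "\<And>s. s < t \<Longrightarrow> ray_min g z s"
  shows "ray_min g z t"
proof (cases "t \<le> 0")
  case True then show ?thesis by (rule ray_min_nonpos)
next
  case False
  then have t: "0 < t" by simp
  show ?thesis unfolding ray_min_def
  proof
    fix y assume y: "y \<in> cball (X g z t) t"
    define p where "p s = X g z s + (s / t) *\<^sub>R (y - X g z t)" for s
    have "(p \<longlongrightarrow> X g z t + (t / t) *\<^sub>R (y - X g z t)) (at_left t)"
      unfolding p_def X_eq using t by (intro tendsto_intros) simp
    then have "((\<lambda>s. g (p s)) \<longlongrightarrow> g y) (at_left t)"
      using t by (intro C1_tendsto[OF g]) simp
    moreover have "\<forall>\<^sub>F s in at_left t. g z \<le> g (p s)"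
    proof -
      have "\<forall>\<^sub>F s in at_left t. s \<in> {0<..<t}" using t by (rule eventually_at_left_real)
      then show ?thesis
      proof eventually_elim
        case (elim s)
        then have "p s \<in> cball (X g z s) s"
          unfolding p_def by (intro shifted_mem_cball[OF t y]) simp
        with le[of s] elim show ?case unfolding ray_min_def by auto
      qed
    qed
    ultimately show "g z \<le> g y"
      by (intro tendsto_le[OF trivial_limit_at_left_real _ tendsto_const])
  qed
qed

lemma ts_bar_le_iff:
  assumes g: "C1 g" and nz: "grad g z \<noteq> 0" and t: "0 \<le> t"
  shows "ts_bar g z \<le> ennreal t \<longleftrightarrow> (\<forall>s>t. \<not> ray_strict_min g z s)"
proof -
  have "ts_bar g z \<le> ennreal t \<longleftrightarrow> (\<forall>s. (0 < s \<and> minimizer g (X g z s) s z \<and>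
      (\<forall>y. minimizer g (X g z s) s y \<longrightarrow> y = z)) \<longrightarrow> ennreal s \<le> ennreal t)"
    unfolding ts_bar_def Sup_le_iff by blast
  also have "\<dots> \<longleftrightarrow> (\<forall>s. 0 < s \<and> ray_strict_min g z s \<longrightarrow> s \<le> t)"
  proof (rule iff_allI)
    fix s
    show "(0 < s \<and> minimizer g (X g z s) s z \<and> (\<forall>y. minimizer g (X g z s) s y \<longrightarrow> y = z) \<longrightarrow>
        ennreal s \<le> ennreal t) \<longleftrightarrow> (0 < s \<and> ray_strict_min g z s \<longrightarrow> s \<le> t)"
      using unique_minimizer_ray_iff[OF g nz, of s] ennreal_le_iff[OF t, of s] less_imp_le[of 0 s] by argo
  qed
  also have "\<dots> \<longleftrightarrow> (\<forall>s>t. \<not> ray_strict_min g z s)"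
  proof (rule iff_allI)
    fix s
    show "(0 < s \<and> ray_strict_min g z s \<longrightarrow> s \<le> t) \<longleftrightarrow> (t < s \<longrightarrow> \<not> ray_strict_min g z s)"
      using t by argo
  qed
  finally show ?thesis .
qed

lemma le_ts_iff:
  assumes g: "C1 g" and nz: "grad g z \<noteq> 0" and t: "0 \<le> t"
  shows "ennreal t \<le> ts g z \<longleftrightarrow> ray_min g z t"
proof -
  have "ennreal t \<le> ts g z \<longleftrightarrow>
      (\<forall>s. 0 < s \<and> \<not> minimizer g (X g z s) s z \<longrightarrow> ennreal t \<le> ennreal s)"
    unfolding ts_def le_Inf_iff by blast
  also have "\<dots> \<longleftrightarrow> (\<forall>s. 0 < s \<and> \<not> ray_min g z s \<longrightarrow> t \<le> s)"
  proof (rule iff_allI)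
    fix s
    show "(0 < s \<and> \<not> minimizer g (X g z s) s z \<longrightarrow> ennreal t \<le> ennreal s) \<longleftrightarrow>
        (0 < s \<and> \<not> ray_min g z s \<longrightarrow> t \<le> s)"
      using minimizer_ray_iff[OF g nz, of s] ennreal_le_iff[of s t] less_imp_le[of 0 s] by argo
  qed
  also have "\<dots> \<longleftrightarrow> ray_min g z t"
  proof
    assume l: "\<forall>s. 0 < s \<and> \<not> ray_min g z s \<longrightarrow> t \<le> s"
    show "ray_min g z t"
    proof (rule ray_min_left_limit[OF g])
      fix s assume "s < t"
      then show "ray_min g z s" using l[rule_format, of s] ray_min_nonpos[of s g z] by argo
    qed
  next
    assume m: "ray_min g z t"
    show "\<forall>s. 0 < s \<and> \<not> ray_min g z s \<longrightarrow> t \<le> s"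
    proof (intro allI impI)
      fix s assume "0 < s \<and> \<not> ray_min g z s"
      then show "t \<le> s" using ray_min_mono[OF nz _ m, of s] by argo
    qed
  qed
  finally show ?thesis .
qed

lemma T_eq_fibres:
  assumes g: "C1 g" and S: "\<And>z. z \<in> S \<Longrightarrow> grad g z \<noteq> 0"
  shows "T g S = (\<Union>z\<in>S. (\<lambda>t. (X g z t, t)) ` fibre g z)"
proof -
  have "t \<in> fibre g z \<longleftrightarrow> 0 \<le> t \<and> ts_bar g z \<le> ennreal t \<and> ennreal t \<le> ts g z" if "z \<in> S" for z t
    using ts_bar_le_iff[OF g S[OF that]] le_ts_iff[OF g S[OF that]] by (auto simp: fibre_def)
  then show ?thesis unfolding T_def by blast
qed

lemma M_iff:
  assumes g: "C1 g"
  shows "z \<in> M g \<longleftrightarrow> grad g z \<noteq> 0 \<and> (\<exists>r. \<forall>s>r. \<not> ray_strict_min g z s)"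
proof (cases "grad g z = 0")
  case False
  have "ts_bar g z < \<infinity> \<longleftrightarrow> (\<exists>r\<ge>0. ts_bar g z \<le> ennreal r)"
    by (metis ennreal_cases ennreal_less_top infinity_ennreal_def le_less_trans order_refl top.not_eq_extremum)
  also have "\<dots> \<longleftrightarrow> (\<exists>r\<ge>0. \<forall>s>r. \<not> ray_strict_min g z s)"
    using ts_bar_le_iff[OF g False] by blast
  also have "\<dots> \<longleftrightarrow> (\<exists>r. \<forall>s>r. \<not> ray_strict_min g z s)"
    using ray_strict_min_nonpos[of 0 g z] by (metis not_le order_refl)
  finally show ?thesis using False by (simp add: M_def)
qed (simp add: M_def)

text \<open>The number \<open>b\<close> is \<open>ts_bar g z\<close>; it belongs to the fibre even if it is \<open>0\<close>, since at time
  \<open>0\<close> the ball is a single point.\<close>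

lemma fibre_least:
  assumes g: "C1 g" and z: "z \<in> M g"
  obtains b where "b \<in> fibre g z" "\<And>s. s < b \<Longrightarrow> ray_strict_min g z s"
proof -
  obtain r where nz: "grad g z \<noteq> 0" and r: "\<And>s. r < s \<Longrightarrow> \<not> ray_strict_min g z s"
    using z M_iff[OF g] by blast
  define A where "A = {s. ray_strict_min g z s}"
  have A0: "0 \<in> A" by (simp add: A_def ray_strict_min_nonpos)
  have bdd: "bdd_above A" using r by (intro bdd_aboveI[of _ r]) (auto simp: A_def not_less[symmetric])
  have b: "ray_strict_min g z s" if "s < Sup A" for s
    using that less_cSup_iff[OF _ bdd] A0 ray_strict_min_mono[OF nz, of s] by (force simp: A_def)
  have "0 \<le> Sup A" using A0 bdd by (rule cSup_upper)
  moreover have "\<not> ray_strict_min g z s" if "Sup A < s" for s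
    using that cSup_upper[OF _ bdd, of s] by (force simp: A_def)
  moreover have "ray_min g z (Sup A)"
    by (rule ray_min_left_limit[OF g]) (use b ray_strict_min_imp_min in blast)
  ultimately have "Sup A \<in> fibre g z" by (simp add: fibre_def)
  then show ?thesis using that b by blast
qed

lemma convex_fibre: "grad g z \<noteq> 0 \<Longrightarrow> a \<in> fibre g z \<Longrightarrow> b \<in> fibre g z \<Longrightarrow> a \<le> c \<Longrightarrow> c \<le> b \<Longrightarrow> c \<in> fibre g z"
  using ray_min_mono[of g z c b] by (auto simp: fibre_def)

text \<open>If a point with \<open>t > 0\<close> has two minimizers, one of which has non-zero gradient, then both
  cannot have the same gradient, since the gradient determines such a minimizer. Hence \<open>u\<close> is not
  differentiable there. Conversely, at a singular point two minimizers must induce different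
  linear forms, so one of them has non-zero gradient and is not the only minimizer.\<close>

theorem Sigma_T1_eq:
  assumes g: "C1 g"
  shows "Sigma_sing g \<union> T1 g = T g (M g)"
proof (intro set_eqI iffI)
  have nzM: "\<And>z. z \<in> M g \<Longrightarrow> grad g z \<noteq> 0" using M_iff[OF g] by blast
  note TM = T_eq_fibres[OF g nzM]
  fix p assume p: "p \<in> T g (M g)"
  then obtain z t where z: "z \<in> M g" "t \<in> fibre g z" and pt: "p = (X g z t, t)" by (auto simp: TM)
  note nz = nzM[OF z(1)]
  have t0: "0 \<le> t" and "ray_min g z t" using z(2) by (auto simp: fibre_def)
  then have min: "minimizer g (X g z t) t z" using minimizer_ray_iff[OF g nz t0] by blast
  show "p \<in> Sigma_sing g \<union> T1 g"
  proof (cases "\<exists>!y. minimizer g (X g z t) t y")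
    case True
    then show ?thesis using p by (simp add: pt T1_def)
  next
    case False
    then obtain y where y: "minimizer g (X g z t) t y" "y \<noteq> z" using min by blast
    have "t \<noteq> 0"
    proof
      assume "t = 0"
      with y min show False by (simp add: minimizer_iff[OF g])
    qed
    moreover have "\<not> (\<lambda>(x, t). u g x t) differentiable (at (X g z t, t))"
    proof
      assume "(\<lambda>(x, t). u g x t) differentiable (at (X g z t, t))"
      then have eq: "grad g y = grad g z" using grad_eq_of_differentiable[OF g _ y(1) min] by blast
      then have "X g z t = X g y t" using minimizer_on_ray[OF g y(1)] nz by simp
      then show False using y(2) eq by (simp add: X_def)
    qed
    ultimately show ?thesis using t0 by (simp add: pt Sigma_sing_def)
  qed
next
  have nzM: "\<And>z. z \<in> M g \<Longrightarrow> grad g z \<noteq> 0" using M_iff[OF g] by blast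
  note TM = T_eq_fibres[OF g nzM]
  fix p assume "p \<in> Sigma_sing g \<union> T1 g"
  then show "p \<in> T g (M g)"
  proof
    assume "p \<in> Sigma_sing g"
    then obtain x t where p: "p = (x, t)" and t: "0 < t"
      and nd: "\<not> (\<lambda>(x, t). u g x t) differentiable (at (x, t))" by (auto simp: Sigma_sing_def)
    obtain y1 where y1: "minimizer g x t y1" using minimizer_exists[OF g] t by (meson less_imp_le)
    obtain y2 where y2: "minimizer g x t y2" and ne: "shift_form g x t y2 \<noteq> shift_form g x t y1"
      using u_differentiable[OF g t] nd by metis
    have "grad g y1 \<noteq> 0 \<or> grad g y2 \<noteq> 0"
      using ne by (auto simp: shift_form_def fun_eq_iff)
    then obtain y y' where y: "minimizer g x t y" "minimizer g x t y'" "grad g y \<noteq> 0" "y' \<noteq> y"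
      using y1 y2 ne by metis
    have x: "x = X g y t" using minimizer_on_ray[OF g y(1,3)] .
    have "\<not> ray_strict_min g y t"
      using unique_minimizer_ray_iff[OF g y(3), of t] y t x by auto
    then have ns: "\<not> ray_strict_min g y s" if "t < s" for s
      using ray_strict_min_mono[OF y(3), of t s] that by auto
    then have "y \<in> M g" using y(3) M_iff[OF g] by blast
    moreover have "t \<in> fibre g y"
      using ns t minimizer_ray_min[OF g y(1,3)] by (simp add: fibre_def)
    ultimately show ?thesis by (auto simp: TM p x)
  qed (auto simp: T1_def)
qed

section \<open>The sets \<open>E\<close> and \<open>F\<close>\<close>

lemma open_E:
  assumes g: "C1 g" shows "open (E g)"
proof -
  have "E g = (\<Union>y. {z. 0 < (y - z) \<bullet> grad g z} \<inter> {z. g y < g z})"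
    by (auto simp: E_def H_def)
  moreover have "open ({z. 0 < (y - z) \<bullet> grad g z} \<inter> {z. g y < g z})" for y
    using g C1_continuous[OF g]
    by (intro open_Int open_Collect_less continuous_intros) (auto simp: C1_def)
  ultimately show ?thesis by auto
qed

lemma path_components_E:
  assumes g: "C1 g"
  shows "countable (path_components (E g))" "\<Union>(path_components (E g)) = E g"
    "\<And>Ei. Ei \<in> path_components (E g) \<Longrightarrow> open Ei \<and> connected Ei \<and> Ei \<noteq> {} \<and> Ei \<subseteq> E g"
proof -
  have eq: "path_components (E g) = components (E g)"
    unfolding path_components_def components_def
    using path_component_eq_connected_component_set[OF open_imp_locally_path_connected[OF open_E[OF g]]] by simp
  show "\<Union>(path_components (E g)) = E g" by (simp add: eq Union_components[symmetric])
  show *: "\<And>Ei. Ei \<in> path_components (E g) \<Longrightarrow> open Ei \<and> connected Ei \<and> Ei \<noteq> {} \<and> Ei \<subseteq> E g"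
    unfolding eq
    using open_components[OF open_E[OF g]] in_components_connected in_components_nonempty in_components_subset
    by metis
  show "countable (path_components (E g))"
    by (rule countable_disjoint_open_subsets)
      (use * pairwise_disjoint_components[of "E g"] in \<open>auto simp: eq pairwise_def disjnt_def\<close>)
qed

lemma connected_subset_path_component:
  assumes g: "C1 g" and C: "connected C" "C \<noteq> {}" "C \<subseteq> E g"
  obtains Ei where "Ei \<in> path_components (E g)" "C \<subseteq> Ei"
proof -
  obtain p where p: "p \<in> C" using C by blast
  have "C \<subseteq> connected_component_set (E g) p" by (rule connected_component_maximal[OF p C(1,3)])
  also have "\<dots> = path_component_set (E g) p"
    using path_component_eq_connected_component_set[OF open_imp_locally_path_connected[OF open_E[OF g]]] by simp
  finally show ?thesis using that p C(3) unfolding path_components_def by blast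
qed

text \<open>The balls of the ray of \<open>z\<close> exhaust the half space \<open>H g z\<close>.\<close>

lemma competitor_in_balls:
  assumes nz: "grad g z \<noteq> 0" and y: "y \<in> H g z"
  obtains r where "0 < r" "\<And>t. r < t \<Longrightarrow> y \<in> ball (X g z t) t"
proof -
  define a where "a = (y - z) \<bullet> dir g z"
  have "0 < norm (grad g z) * a" using y inner_grad_eq_dir[of "y - z" g z] by (simp add: H_def a_def)
  then have a: "0 < a" by (simp add: zero_less_mult_iff)
  define r where "r = (norm (y - z))\<^sup>2 / (2 * a)"
  have "y \<noteq> z" using a by (auto simp: a_def)
  then have r: "0 < r" using a by (simp add: r_def)
  have "y \<in> ball (X g z t) t" if "r < t" for t
  proof -
    have "(norm (y - z))\<^sup>2 < 2 * t * a" using that a by (simp add: r_def field_simps)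
    then show ?thesis using mem_ball_X[OF nz, of t y] r that by (simp add: a_def)
  qed
  with r that show ?thesis by blast
qed

lemma E_subset_M:
  assumes g: "C1 g" shows "E g \<subseteq> M g"
proof
  fix z assume "z \<in> E g"
  then obtain y where nz: "grad g z \<noteq> 0" and y: "y \<in> H g z" "g y < g z" by (auto simp: E_def)
  obtain r where r: "\<And>t. r < t \<Longrightarrow> y \<in> ball (X g z t) t" using competitor_in_balls[OF nz y(1)] by blast
  have "\<not> ray_strict_min g z t" if "r < t" for t
  proof
    assume "ray_strict_min g z t"
    then have "g z \<le> g y" using ray_strict_min_imp_min r[OF that] by (fastforce simp: ray_min_def)
    with y(2) show False by simp
  qed
  with nz show "z \<in> M g" using M_iff[OF g] by blast
qed

lemma cball_X_subset_H:
  assumes nz: "grad g z \<noteq> 0" and y: "y \<in> cball (X g z t) t" "y \<noteq> z"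
  shows "y \<in> H g z"
proof -
  have "0 \<le> t" using y(1) by (meson dual_order.trans mem_cball zero_le_dist)
  then have "0 < (y - z) \<bullet> dir g z" using inner_dir_pos[OF nz _ y] by blast
  then show ?thesis using nz inner_grad_eq_dir[of "y - z" g z] by (simp add: H_def)
qed

lemma ray_min_outside_E:
  assumes "grad g z \<noteq> 0" "z \<notin> E g"
  shows "ray_min g z t"
  unfolding ray_min_def
proof
  fix y assume "y \<in> cball (X g z t) t"
  then show "g z \<le> g y"
    using cball_X_subset_H[of g z y t] assms by (cases "y = z") (auto simp: E_def not_less)
qed

text \<open>A fixed small translation in the direction of the gradient at \<open>z\<close> carries each nearby point of
  the superlevel set, along a segment inside that set, into a small ball around a common point.\<close>

lemma superlevel_locally_connected:
  assumes g: "C1 g" and nz: "grad g z \<noteq> 0" and \<rho>: "0 < \<rho>"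
  obtains \<delta> C where "0 < \<delta>" "connected C" "C \<noteq> {}" "{w. g z < g w} \<inter> ball z \<delta> \<subseteq> C"
    "C \<subseteq> {w. g z < g w} \<inter> ball z \<rho>"
proof -
  define n where "n = dir g z"
  have n1: "norm n = 1" using norm_dir[OF nz] by (simp add: n_def)
  have "0 < n \<bullet> grad g z"
  proof -
    have "n \<bullet> n = 1" using n1 by (simp add: norm_eq_1)
    then show ?thesis using nz inner_grad_eq_dir[of n g z] by (simp add: n_def)
  qed
  moreover have "((\<lambda>w. n \<bullet> grad g w) \<longlongrightarrow> n \<bullet> grad g z) (nhds z)"
    by (intro tendsto_inner tendsto_const C1_tendsto_grad[OF g] filterlim_ident)
  ultimately have "\<forall>\<^sub>F w in nhds z. 0 < n \<bullet> grad g w" by (intro order_tendstoD(1))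
  then obtain r0 where r0: "0 < r0" "\<And>w. dist w z < r0 \<Longrightarrow> 0 < n \<bullet> grad g w"
    by (auto simp: eventually_nhds_metric)
  define r where "r = min r0 \<rho>"
  define h where "h = r / 2"
  have r: "0 < r" "r \<le> r0" "r \<le> \<rho>" and h: "0 < h" using r0 \<rho> by (auto simp: r_def h_def)
  \<comment> \<open>Since \<open>h\<close> is half of \<open>r\<close>, moving by at most \<open>h\<close> from \<open>ball z h\<close> stays in \<open>ball z r\<close>, where \<open>g\<close>
    increases in direction \<open>n\<close>.\<close>
  have up: "g w < g (w + s *\<^sub>R n)" if "dist w z < r - s" "0 < s" for w s
  proof -
    obtain \<theta> where \<theta>: "0 \<le> \<theta>" "\<theta> \<le> 1" "g (w + s *\<^sub>R n) - g w = (s *\<^sub>R n) \<bullet> grad g (w + \<theta> *\<^sub>R (s *\<^sub>R n))"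
      using C1_mvt[OF g] by blast
    have "dist (w + \<theta> *\<^sub>R (s *\<^sub>R n)) z \<le> dist w z + \<theta> * s"
      using norm_triangle_ineq[of "w - z" "\<theta> *\<^sub>R (s *\<^sub>R n)"] n1 \<theta> that(2) by (simp add: dist_norm algebra_simps)
    also have "dist w z + \<theta> * s < r0"
    proof -
      have "\<theta> * s \<le> s" using that(2) \<theta> by (intro mult_left_le_one_le) auto
      then show ?thesis using that r by linarith
    qed
    finally have "0 < n \<bullet> grad g (w + \<theta> *\<^sub>R (s *\<^sub>R n))" by (rule r0(2))
    then have "0 < s * (n \<bullet> grad g (w + \<theta> *\<^sub>R (s *\<^sub>R n)))" using that(2) by (intro mult_pos_pos)
    with \<theta>(3) show ?thesis by (simp del: scaleR_scaleR)
  qed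
  define p where "p = z + h *\<^sub>R n"
  have gp: "g z < g p" unfolding p_def using h r by (intro up) (auto simp: h_def)
  have "\<forall>\<^sub>F w in nhds p. g z < g w"
    by (rule order_tendstoD(1)[OF C1_tendsto[OF g filterlim_ident] gp])
  then obtain d0 where d0: "0 < d0" "\<And>w. dist w p < d0 \<Longrightarrow> g z < g w"
    by (auto simp: eventually_nhds_metric)
  define \<delta> where "\<delta> = min d0 h"
  have \<delta>: "0 < \<delta>" "\<delta> \<le> d0" "\<delta> \<le> h" using d0 h by (auto simp: \<delta>_def)
  define A where "A = {w. g z < g w} \<inter> ball z \<delta>"
  define S where "S w = ball p \<delta> \<union> closed_segment w (w + h *\<^sub>R n)" for w
  define C where "C = ball p \<delta> \<union> (\<Union>w\<in>A. S w)"
  have end_in: "w + h *\<^sub>R n \<in> ball p \<delta>" if "w \<in> A" for w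
    using that by (simp add: A_def p_def dist_norm norm_minus_commute)
  have "connected (S w)" if "w \<in> A" for w
    unfolding S_def using end_in[OF that] by (intro connected_Un) auto
  then have "connected (\<Union>(insert (ball p \<delta>) (S ` A)))"
    by (intro connected_Union) (use \<delta>(1) in \<open>auto simp: S_def intro!: exI[of _ p]\<close>)
  then have con: "connected C" by (simp add: C_def)
  have ballp: "ball p \<delta> \<subseteq> {w. g z < g w} \<inter> ball z \<rho>"
  proof
    fix w assume w: "w \<in> ball p \<delta>"
    have "dist z w \<le> dist z p + dist p w" by (rule dist_triangle)
    also have "dist z p = h" using h n1 by (simp add: p_def dist_norm)
    finally have "dist z w < \<rho>" using w \<delta> r by (simp add: h_def)
    moreover have "g z < g w" using d0(2)[of w] w \<delta> by (simp add: dist_commute)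
    ultimately show "w \<in> {w. g z < g w} \<inter> ball z \<rho>" by simp
  qed
  have seg: "closed_segment w (w + h *\<^sub>R n) \<subseteq> {w. g z < g w} \<inter> ball z \<rho>" if w: "w \<in> A" for w
  proof
    fix v assume "v \<in> closed_segment w (w + h *\<^sub>R n)"
    then obtain \<theta> where \<theta>: "0 \<le> \<theta>" "\<theta> \<le> 1" "v = (1 - \<theta>) *\<^sub>R w + \<theta> *\<^sub>R (w + h *\<^sub>R n)"
      by (auto simp: in_segment)
    define s where "s = \<theta> * h"
    have s: "0 \<le> s" "s \<le> h" using \<theta> h by (auto simp: s_def mult_left_le_one_le)
    have v: "v = w + s *\<^sub>R n" using \<theta>(3) by (simp add: s_def algebra_simps)
    have wz: "dist w z < h" "g z < g w" using w \<delta> by (auto simp: A_def dist_commute)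
    have "g w \<le> g v"
    proof (cases "s = 0")
      case False
      then have "g w < g (w + s *\<^sub>R n)" using s wz by (intro up) (auto simp: h_def)
      then show ?thesis by (simp add: v)
    qed (simp add: v)
    moreover have "dist z v < \<rho>"
    proof -
      have "dist v z \<le> dist w z + s"
        using norm_triangle_ineq[of "w - z" "s *\<^sub>R n"] n1 s by (simp add: v dist_norm algebra_simps)
      then show ?thesis using wz s r by (simp add: h_def dist_commute)
    qed
    ultimately show "v \<in> {w. g z < g w} \<inter> ball z \<rho>" using wz by simp
  qed
  have "A \<subseteq> C" by (auto simp: C_def S_def)
  moreover have "C \<subseteq> {w. g z < g w} \<inter> ball z \<rho>" using ballp seg by (auto simp: C_def S_def)
  moreover have "p \<in> C" using \<delta>(1) by (simp add: C_def)
  ultimately show ?thesis using that[OF \<delta>(1) con] unfolding A_def by blast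
qed

text \<open>A point of \<open>M g\<close> outside \<open>E g\<close> minimizes \<open>g\<close> on every ball of its ray but not strictly on
  large ones, so some \<open>y\<close> in the open half space \<open>H g z\<close> has \<open>g y = g z\<close>.\<close>

lemma equal_competitor:
  assumes g: "C1 g" and z: "z \<in> M g" "z \<notin> E g" and b: "\<And>s. b < s \<Longrightarrow> \<not> ray_strict_min g z s"
    and t: "b < t" "0 \<le> b"
  obtains y where "y \<in> ball (X g z t) t" "y \<in> H g z" "g y = g z"
proof -
  have nz: "grad g z \<noteq> 0" using z M_iff[OF g] by blast
  define s where "s = (b + t) / 2"
  have s: "b < s" "s < t" "0 \<le> s" using t by (auto simp: s_def)
  obtain y where y: "y \<in> cball (X g z s) s" "y \<noteq> z" "\<not> g z < g y"
    using b[OF s(1)] unfolding ray_strict_min_def by blast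
  have "g z \<le> g y" using ray_min_outside_E[OF nz z(2), of s] y(1) unfolding ray_min_def by blast
  then have "g y = g z" using y(3) by simp
  then show ?thesis using that cball_X_subset_ball[OF nz s(3,2) y(1,2)] cball_X_subset_H[OF nz y(1,2)] by blast
qed

text \<open>Such a \<open>y\<close> is a strictly better competitor for all nearby points with a larger value of
  \<open>g\<close>, so these lie in \<open>E g\<close>.\<close>

lemma superlevel_near_in_E:
  assumes g: "C1 g" and z: "z \<in> M g" "z \<notin> E g"
  obtains \<rho> where "0 < \<rho>" "{w. g z < g w} \<inter> ball z \<rho> \<subseteq> E g"
proof -
  obtain r where nz: "grad g z \<noteq> 0" and r: "\<And>s. r < s \<Longrightarrow> \<not> ray_strict_min g z s"
    using z M_iff[OF g] by blast
  obtain y where y: "y \<in> H g z" "g y = g z"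
    using equal_competitor[OF g z, of "max r 0" "max r 0 + 1"] r by auto
  have "((\<lambda>w. (y - w) \<bullet> grad g w) \<longlongrightarrow> (y - z) \<bullet> grad g z) (nhds z)"
    by (intro tendsto_inner tendsto_diff tendsto_const C1_tendsto_grad[OF g] filterlim_ident)
  then have "\<forall>\<^sub>F w in nhds z. 0 < (y - w) \<bullet> grad g w"
    using y(1) by (intro order_tendstoD(1)) (auto simp: H_def)
  then obtain \<rho> where \<rho>: "0 < \<rho>" "\<And>w. dist w z < \<rho> \<Longrightarrow> 0 < (y - w) \<bullet> grad g w"
    by (auto simp: eventually_nhds_metric)
  have "w \<in> E g" if "g z < g w" "dist z w < \<rho>" for w
  proof -
    have "0 < (y - w) \<bullet> grad g w" using \<rho>(2)[of w] that by (simp add: dist_commute)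
    then show ?thesis using y(2) that(1) by (auto simp: E_def H_def)
  qed
  with \<rho>(1) that show ?thesis by (metis (no_types, lifting) Int_iff mem_Collect_eq mem_ball subsetI)
qed

lemma F_subset_M:
  assumes g: "C1 g" and Ei: "Ei \<in> path_components (E g)"
  shows "F g Ei \<subseteq> M g"
  using path_components_E(3)[OF g Ei] E_subset_M[OF g] by (auto simp: F_def)

lemma M_eq_Union_F:
  assumes g: "C1 g"
  shows "M g = (\<Union>Ei\<in>path_components (E g). F g Ei)"
proof
  show "(\<Union>Ei\<in>path_components (E g). F g Ei) \<subseteq> M g" using F_subset_M[OF g] by blast
  show "M g \<subseteq> (\<Union>Ei\<in>path_components (E g). F g Ei)"
  proof
    fix z assume z: "z \<in> M g"
    show "z \<in> (\<Union>Ei\<in>path_components (E g). F g Ei)"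
    proof (cases "z \<in> E g")
      case True
      then show ?thesis using path_components_E(2)[OF g] by (auto simp: F_def)
    next
      case False
      have nz: "grad g z \<noteq> 0" using z M_iff[OF g] by blast
      obtain \<rho> where \<rho>: "0 < \<rho>" "{w. g z < g w} \<inter> ball z \<rho> \<subseteq> E g"
        using superlevel_near_in_E[OF g z False] by blast
      obtain \<delta> C where C: "0 < \<delta>" "connected C" "C \<noteq> {}" "{w. g z < g w} \<inter> ball z \<delta> \<subseteq> C"
        "C \<subseteq> {w. g z < g w} \<inter> ball z \<rho>" using superlevel_locally_connected[OF g nz \<rho>(1)] by metis
      obtain Ei where Ei: "Ei \<in> path_components (E g)" "C \<subseteq> Ei"
        using connected_subset_path_component[OF g C(2,3)] C(5) \<rho>(2) by blast
      have "Hplus g (ball z \<delta>) z \<subseteq> Ei" using C(4) Ei(2) by (auto simp: Hplus_def)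
      then have "z \<in> F g Ei"
        using z False C(1) by (auto simp: F_def intro!: exI[of _ "ball z \<delta>"])
      with Ei(1) show ?thesis by blast
    qed
  qed
qed

section \<open>Colourings of characteristics are locally constant\<close>

text \<open>The minimizer map \<open>x \<mapsto> \<zeta> x\<close> at a fixed time is continuous and injective where all minimizers
  are unique and regular: \<open>x\<close> is recovered from \<open>\<zeta> x\<close> as \<open>X g (\<zeta> x) t\<close>. By invariance of domain its
  image is open, so that every point near a minimizer is itself a minimizer.\<close>

lemma ray_min_nhds:
  assumes g: "C1 g" and t: "0 < t" and V: "open V" "z \<in> V" and z: "ray_strict_min g z t"
    and nz: "\<And>w. w \<in> V \<Longrightarrow> grad g w \<noteq> 0"
    and strict: "\<And>w. w \<in> V \<Longrightarrow> ray_min g w t \<Longrightarrow> ray_strict_min g w t"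
  obtains \<delta> where "0 < \<delta>" "\<And>w. w \<in> ball z \<delta> \<Longrightarrow> ray_min g w t"
proof -
  have t0: "0 \<le> t" using t by simp
  define \<zeta> where "\<zeta> x = (SOME y. minimizer g x t y)" for x
  have \<zeta>: "minimizer g x t (\<zeta> x)" for x
    unfolding \<zeta>_def using someI_ex[OF minimizer_exists[OF g t0]] .
  have uni: "minimizer g (X g w t) t y \<longleftrightarrow> y = w" if "w \<in> V" "ray_min g w t" for w y
    using unique_minimizer_ray_iff[OF g nz[OF that(1)] t0] strict[OF that] by blast
  define x0 where "x0 = X g z t"
  have z0: "y = z" if "minimizer g x0 t y" for y
    using that uni[OF V(2) ray_strict_min_imp_min[OF z]] by (simp add: x0_def)
  then have "y \<in> V" if "minimizer g x0 t y" for y using that V(2) by blast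
  then obtain r where r: "0 < r" "\<And>x y. dist x x0 < r \<Longrightarrow> minimizer g x t y \<Longrightarrow> y \<in> V"
    using minimizers_stable[OF g t _ V(1)] by metis
  have *: "\<zeta> x \<in> V" "X g (\<zeta> x) t = x" "ray_min g (\<zeta> x) t" if "x \<in> ball x0 r" for x
  proof -
    show V: "\<zeta> x \<in> V" using r(2)[OF _ \<zeta>[of x]] that by (simp add: dist_commute)
    show "X g (\<zeta> x) t = x" using minimizer_on_ray[OF g \<zeta>[of x] nz[OF V]] by simp
    show "ray_min g (\<zeta> x) t" using minimizer_ray_min[OF g \<zeta>[of x] nz[OF V]] .
  qed
  have "isCont \<zeta> x" if x: "x \<in> ball x0 r" for x
    unfolding isCont_def
  proof (rule topological_tendstoI)
    fix W assume W: "open W" "\<zeta> x \<in> W"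
    have "y \<in> W" if "minimizer g x t y" for y
      using uni[OF *(1,3)[OF x], of y] that *(2)[OF x] W(2) by simp
    then obtain r' where "0 < r'" "\<And>x' y. dist x' x < r' \<Longrightarrow> minimizer g x' t y \<Longrightarrow> y \<in> W"
      using minimizers_stable[OF g t _ W(1)] by metis
    then show "\<forall>\<^sub>F x' in at x. \<zeta> x' \<in> W" using \<zeta> unfolding eventually_at by blast
  qed
  then have "continuous_on (ball x0 r) \<zeta>" by (intro continuous_at_imp_continuous_on ballI)
  moreover have "inj_on \<zeta> (ball x0 r)" using *(2) by (intro inj_onI) metis
  ultimately have "open (\<zeta> ` ball x0 r)" by (intro invariance_of_domain open_ball)
  moreover have "z \<in> \<zeta> ` ball x0 r" using z0[OF \<zeta>[of x0]] r(1) by (intro image_eqI[of _ _ x0]) auto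
  ultimately obtain \<delta> where "0 < \<delta>" "ball z \<delta> \<subseteq> \<zeta> ` ball x0 r" using openE by blast
  then show ?thesis using that *(3) by blast
qed

text \<open>The number \<open>e\<close> is \<open>ts g z\<close>.\<close>

lemma fibre_greatest:
  assumes g: "C1 g" and nz: "grad g z \<noteq> 0" and bound: "\<And>t. ray_min g z t \<Longrightarrow> t \<le> r"
  obtains e where "e \<in> fibre g z" "\<And>t. ray_min g z t \<Longrightarrow> t \<le> e"
proof -
  define A where "A = {t. ray_min g z t}"
  have A0: "0 \<in> A" by (simp add: A_def ray_min_nonpos)
  have bdd: "bdd_above A" using bound by (intro bdd_aboveI[of _ r]) (simp add: A_def)
  have le: "t \<le> Sup A" if "ray_min g z t" for t using that bdd by (intro cSup_upper) (auto simp: A_def)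
  have "ray_min g z (Sup A)"
  proof (rule ray_min_left_limit[OF g])
    fix s assume "s < Sup A"
    then obtain t where "ray_min g z t" "s < t" using less_cSup_iff[OF _ bdd] A0 by (auto simp: A_def)
    then show "ray_min g z s" using ray_min_mono[OF nz, of s t] by simp
  qed
  moreover have "0 \<le> Sup A" using le[OF ray_min_nonpos[of 0]] by simp
  moreover have "\<not> ray_strict_min g z s" if "Sup A < s" for s
    using le[of s] ray_strict_min_imp_min[of g z s] that by linarith
  ultimately have "Sup A \<in> fibre g z" by (simp add: fibre_def)
  with le that show ?thesis by blast
qed

text \<open>The time difference counts twice: once as a displacement along the ray of \<open>y\<close> and once as the
  difference of the time components.\<close>

lemma rays_close:
  assumes g: "C1 g" and nz: "grad g y \<noteq> 0" and \<eta>: "0 < \<eta>" and r: "0 \<le> r"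
  obtains \<delta> where "0 < \<delta>" "\<And>z s t. dist z y < \<delta> \<Longrightarrow> 0 \<le> s \<Longrightarrow> s \<le> r \<Longrightarrow>
    dist (X g z s, s) (X g y t, t) < \<eta> + 2 * \<bar>s - t\<bar>"
proof -
  have "((\<lambda>z. dist z y + r * norm (dir g z - dir g y)) \<longlongrightarrow> dist y y + r * norm (dir g y - dir g y)) (nhds y)"
    by (intro tendsto_intros dir_tendsto[OF g nz] filterlim_ident)
  then have "\<forall>\<^sub>F z in nhds y. dist z y + r * norm (dir g z - dir g y) < \<eta>"
    using \<eta> by (intro order_tendstoD(2)) auto
  then obtain \<delta> where \<delta>: "0 < \<delta>" "\<And>z. dist z y < \<delta> \<Longrightarrow> dist z y + r * norm (dir g z - dir g y) < \<eta>"
    by (auto simp: eventually_nhds_metric)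
  have "dist (X g z s, s) (X g y t, t) < \<eta> + 2 * \<bar>s - t\<bar>" if z: "dist z y < \<delta>" "0 \<le> s" "s \<le> r" for z s t
  proof -
    have "(X g z s, s) - (X g y t, t) =
        ((z - y) + s *\<^sub>R (dir g z - dir g y) + (s - t) *\<^sub>R dir g y, s - t)"
      by (simp add: X_eq algebra_simps)
    then have "dist (X g z s, s) (X g y t, t) \<le>
        norm ((z - y) + s *\<^sub>R (dir g z - dir g y) + (s - t) *\<^sub>R dir g y) + \<bar>s - t\<bar>"
      using norm_Pair_le by (metis dist_norm real_norm_def)
    also have "norm ((z - y) + s *\<^sub>R (dir g z - dir g y) + (s - t) *\<^sub>R dir g y) \<le>
        norm (z - y) + norm (s *\<^sub>R (dir g z - dir g y)) + norm ((s - t) *\<^sub>R dir g y)"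
      by (intro norm_triangle_le add_mono order_refl norm_triangle_ineq)
    also have "norm (s *\<^sub>R (dir g z - dir g y)) \<le> r * norm (dir g z - dir g y)"
      using z by (simp add: mult_right_mono)
    also have "norm ((s - t) *\<^sub>R dir g y) = \<bar>s - t\<bar>" using norm_dir[OF nz] by simp
    finally show ?thesis using \<delta>(2)[OF z(1)] by (simp add: dist_norm)
  qed
  with \<delta>(1) that show ?thesis by blast
qed

text \<open>The heart of the proof. The points of \<open>D\<close> are coloured so that characteristics whose
  singular segments come within \<open>\<epsilon>\<close> of each other have the same colour; the claim is that points of
  \<open>P\<close> near \<open>y\<close> have the colour of \<open>y\<close>. It holds for those \<open>z\<close> that stay minimizers until just
  before the singular segment of \<open>y\<close> begins, at time \<open>b\<close>: their singular segments end near that of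
  \<open>y\<close>. The other \<open>z\<close> are reached by lowering the time in steps of fixed length \<open>\<eta>\<close>. Suppose the
  claim holds for the \<open>z\<close> that survive until \<open>\<tau>\<close>, but \<open>w\<close> of the other colour dies in
  \<open>[\<tau> - \<eta>, \<tau>)\<close>. Then all singular segments near \<open>(X g y \<tau>, \<tau>)\<close> have the other colour, so no survivor
  of time \<open>\<tau>\<close> is at a singular point there. By invariance of domain the survivors form an open
  subset of \<open>P\<close> near \<open>y\<close>; it is also relatively closed, and by connectedness \<open>w\<close> is a survivor, a
  contradiction.

  The open set \<open>P\<close> may have \<open>y\<close> on its boundary. The hypotheses say that characteristics from \<open>P\<close>
  near \<open>y\<close> end not much later than some time \<open>r\<close> of the singular segment of \<open>y\<close>, that \<open>P\<close> is
  connected near \<open>y\<close>, and that before time \<open>b\<close> there are survivors in \<open>P\<close> arbitrarily close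
  to \<open>y\<close>.\<close>

lemma colour_constant_near:
  fixes c :: "real^'n \<Rightarrow> bool"
  assumes g: "C1 g" and \<epsilon>: "0 < \<epsilon>"
    and c: "\<And>z w s t. z \<in> D \<Longrightarrow> w \<in> D \<Longrightarrow> s \<in> fibre g z \<Longrightarrow> t \<in> fibre g w \<Longrightarrow>
      dist (X g z s, s) (X g w t, t) < \<epsilon> \<Longrightarrow> c z = c w"
    and D: "D \<subseteq> M g" and P: "open P" "P \<subseteq> D" and y: "y \<in> D"
    and r: "r \<in> fibre g y"
    and upper: "\<And>\<eta>. 0 < \<eta> \<Longrightarrow> \<exists>\<delta>>0. \<forall>z\<in>P \<inter> ball y \<delta>. \<forall>t. ray_min g z t \<longrightarrow> t \<le> r + \<eta>"
    and conn: "\<And>\<rho>. 0 < \<rho> \<Longrightarrow> \<exists>\<delta>>0. \<exists>C. connected C \<and> P \<inter> ball y \<delta> \<subseteq> C \<and> C \<subseteq> P \<inter> ball y \<rho>"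
    and dense: "\<And>t \<delta>. 0 < t \<Longrightarrow> ray_strict_min g y t \<Longrightarrow> 0 < \<delta> \<Longrightarrow> \<exists>z\<in>P \<inter> ball y \<delta>. ray_min g z t"
  shows "\<exists>\<delta>>0. \<forall>z\<in>P \<inter> ball y \<delta>. c z = c y"
proof -
  have nzD: "grad g z \<noteq> 0" if "z \<in> D" for z using that D M_iff[OF g] by blast
  note nz = nzD[OF y]
  obtain b where b: "b \<in> fibre g y" "\<And>s. s < b \<Longrightarrow> ray_strict_min g y s"
    using fibre_least[OF g] y D by (metis subsetD)
  have b0: "0 \<le> b" and r0: "0 \<le> r" using b(1) r by (auto simp: fibre_def)
  have br: "b \<le> r"
  proof (rule ccontr)
    assume "\<not> b \<le> r"
    then have "r < (r + b) / 2" "(r + b) / 2 < b" by auto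
    then show False using b(2)[of "(r + b) / 2"] r unfolding fibre_def by blast
  qed
  \<comment> \<open>Below, points over \<open>z\<close> and \<open>w\<close> at distance at most \<open>\<eta>\<close> and \<open>3 * \<eta>\<close> from a point over \<open>y\<close> are
    compared, so \<open>4 * \<eta> < \<epsilon>\<close> is what matters.\<close>
  define \<eta> where "\<eta> = \<epsilon> / 8"
  have \<eta>: "0 < \<eta>" using \<epsilon> by (simp add: \<eta>_def)
  obtain d1 where d1: "0 < d1" "\<And>z t. z \<in> P \<inter> ball y d1 \<Longrightarrow> ray_min g z t \<Longrightarrow> t \<le> r + \<eta>"
    using upper[OF \<eta>] by blast
  obtain d2 where d2: "0 < d2" "\<And>z s t. dist z y < d2 \<Longrightarrow> 0 \<le> s \<Longrightarrow> s \<le> r + \<eta> \<Longrightarrow>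
    dist (X g z s, s) (X g y t, t) < \<eta> + 2 * \<bar>s - t\<bar>"
    using rays_close[OF g nz \<eta>, of "r + \<eta>"] r0 \<eta> by (metis add_nonneg_nonneg less_imp_le)
  have exit: "\<exists>e\<in>fibre g z. e \<le> r + \<eta> \<and> (\<forall>t. ray_min g z t \<longrightarrow> t \<le> e)" if z: "z \<in> P \<inter> ball y d1" for z
  proof -
    have "grad g z \<noteq> 0" using nzD P(2) z by auto
    from fibre_greatest[OF g this, of "r + \<eta>"]
    obtain e where e: "e \<in> fibre g z" "\<And>t. ray_min g z t \<Longrightarrow> t \<le> e"
      using d1(2)[OF z] by blast
    moreover have "e \<le> r + \<eta>" using d1(2)[OF z] e(1) by (simp add: fibre_def)
    ultimately show ?thesis by blast
  qed
  define Good where "Good \<tau> \<longleftrightarrow> (\<exists>\<delta>>0. \<forall>z\<in>P \<inter> ball y \<delta>. ray_min g z \<tau> \<longrightarrow> c z = c y)" for \<tau>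
  have base: "Good (b - \<eta>)" unfolding Good_def
  proof (intro exI conjI ballI impI)
    show "0 < min d1 d2" using d1 d2 by simp
    fix z assume z: "z \<in> P \<inter> ball y (min d1 d2)" and m: "ray_min g z (b - \<eta>)"
    obtain e where e: "e \<in> fibre g z" "e \<le> r + \<eta>" "\<And>t. ray_min g z t \<Longrightarrow> t \<le> e" using exit z by auto
    \<comment> \<open>The time in \<open>fibre g y\<close> closest to \<open>e\<close> among those between \<open>b\<close> and \<open>r\<close>.\<close>
    define t where "t = max b (min e r)"
    have t: "t \<in> fibre g y" using br by (intro convex_fibre[OF nz b(1) r]) (auto simp: t_def)
    have "\<bar>e - t\<bar> \<le> \<eta>" using e(2) e(3)[OF m] br \<eta> by (auto simp: t_def max_def min_def)
    moreover have "dist (X g z e, e) (X g y t, t) < \<eta> + 2 * \<bar>e - t\<bar>"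
      using z e by (intro d2(2)) (auto simp: fibre_def dist_commute)
    ultimately have "dist (X g z e, e) (X g y t, t) < \<epsilon>" using \<eta> by (simp add: \<eta>_def)
    then show "c z = c y" using c[OF _ y e(1) t] z P by auto
  qed
  have step: "Good (\<tau> - \<eta>)" if good: "Good \<tau>" and \<tau>: "0 < \<tau>" "\<tau> < b" for \<tau>
  proof (rule ccontr)
    assume bad: "\<not> Good (\<tau> - \<eta>)"
    obtain d3 where d3: "0 < d3" "\<And>z. z \<in> P \<inter> ball y d3 \<Longrightarrow> ray_min g z \<tau> \<Longrightarrow> c z = c y"
      using good unfolding Good_def by blast
    define \<rho> where "\<rho> = min d1 (min d2 d3)"
    have \<rho>: "0 < \<rho>" "\<rho> \<le> d1" "\<rho> \<le> d2" "\<rho> \<le> d3" using d1 d2 d3 by (auto simp: \<rho>_def)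
    obtain d4 C where C: "0 < d4" "connected C" "P \<inter> ball y d4 \<subseteq> C" "C \<subseteq> P \<inter> ball y \<rho>"
      using conn[OF \<rho>(1)] by blast
    obtain w where w: "w \<in> P \<inter> ball y (min d4 \<rho>)" "ray_min g w (\<tau> - \<eta>)" "c w \<noteq> c y"
      using bad \<rho>(1) C(1) unfolding Good_def by (metis min_less_iff_conj)
    have nw: "\<not> ray_min g w \<tau>" using d3(2)[of w] w \<rho> by auto
    obtain e where e: "e \<in> fibre g w" "e \<le> r + \<eta>" "\<And>t. ray_min g w t \<Longrightarrow> t \<le> e"
      using exit[of w] w \<rho> by auto
    have e1: "\<tau> - \<eta> \<le> e" using e(3) w(2) by blast
    have e2: "e < \<tau>"
    proof (rule ccontr)
      assume "\<not> e < \<tau>"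
      then have "ray_min g w \<tau>" using ray_min_mono[OF nzD, of w \<tau> e] w(1) P(2) e(1) by (auto simp: fibre_def)
      with nw show False by blast
    qed
    have strict: "ray_strict_min g z \<tau>" if z: "z \<in> P \<inter> ball y \<rho>" and m: "ray_min g z \<tau>" for z
    proof (rule ccontr)
      assume n: "\<not> ray_strict_min g z \<tau>"
      have zD: "z \<in> D" "w \<in> D" using z w P by auto
      have "\<not> ray_strict_min g z s" if "\<tau> < s" for s
        using n that ray_strict_min_mono[OF nzD[OF zD(1)], of \<tau> s] by auto
      then have f: "\<tau> \<in> fibre g z" using m \<tau> by (simp add: fibre_def)
      have 1: "dist (X g z \<tau>, \<tau>) (X g y \<tau>, \<tau>) < \<eta> + 2 * \<bar>\<tau> - \<tau>\<bar>"
        using z \<rho> \<tau> br \<eta> by (intro d2(2)) (auto simp: dist_commute)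
      have 2: "dist (X g w e, e) (X g y \<tau>, \<tau>) < \<eta> + 2 * \<bar>e - \<tau>\<bar>"
        using w \<rho> e by (intro d2(2)) (auto simp: dist_commute fibre_def)
      have "dist (X g z \<tau>, \<tau>) (X g w e, e) < \<epsilon>"
        using dist_triangle2[of "(X g z \<tau>, \<tau>)" "(X g w e, e)" "(X g y \<tau>, \<tau>)"] 1 2 e1 e2 \<eta>
        by (simp add: \<eta>_def)
      then have "c z = c w" by (rule c[OF zD f e(1)])
      moreover have "c z = c y" using d3(2) z \<rho> m by auto
      ultimately show False using w(3) by simp
    qed
    define K1 where "K1 = {z \<in> P \<inter> ball y \<rho>. ray_min g z \<tau>}"
    define K2 where "K2 = {z \<in> P \<inter> ball y \<rho>. \<not> ray_min g z \<tau>}"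
    have oV: "open (P \<inter> ball y \<rho>)" using P(1) by auto
    have nzV: "grad g z \<noteq> 0" if "z \<in> P \<inter> ball y \<rho>" for z using nzD P(2) that by auto
    have "open K1" unfolding open_contains_ball
    proof
      fix z assume "z \<in> K1"
      then have z: "z \<in> P \<inter> ball y \<rho>" "ray_min g z \<tau>" by (auto simp: K1_def)
      obtain \<delta> where \<delta>: "0 < \<delta>" "\<And>v. v \<in> ball z \<delta> \<Longrightarrow> ray_min g v \<tau>"
        using ray_min_nhds[OF g \<tau>(1) oV z(1) strict[OF z] nzV strict] by blast
      obtain \<delta>' where "0 < \<delta>'" "ball z \<delta>' \<subseteq> P \<inter> ball y \<rho>" using oV z(1) openE by blast
      with \<delta> show "\<exists>\<delta>>0. ball z \<delta> \<subseteq> K1"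
        by (intro exI[of _ "min \<delta> \<delta>'"]) (auto simp: K1_def subset_iff)
    qed
    moreover have "open K2" unfolding open_contains_ball
    proof
      fix z assume "z \<in> K2"
      then have z: "z \<in> P \<inter> ball y \<rho>" "\<not> ray_min g z \<tau>" by (auto simp: K2_def)
      obtain \<delta> where \<delta>: "0 < \<delta>" "\<And>v. dist v z < \<delta> \<Longrightarrow> \<not> ray_min g v \<tau>"
        using not_ray_min_nhds[OF g nzV[OF z(1)] z(2)] by blast
      obtain \<delta>' where "0 < \<delta>'" "ball z \<delta>' \<subseteq> P \<inter> ball y \<rho>" using oV z(1) openE by blast
      with \<delta> show "\<exists>\<delta>>0. ball z \<delta> \<subseteq> K2"
        by (intro exI[of _ "min \<delta> \<delta>'"]) (auto simp: K2_def subset_iff dist_commute)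
    qed
    moreover have "C \<subseteq> K1 \<union> K2" "K1 \<inter> K2 \<inter> C = {}" using C(4) by (auto simp: K1_def K2_def)
    ultimately have "K1 \<inter> C = {} \<or> K2 \<inter> C = {}" using connectedD[OF C(2)] by blast
    moreover have "K1 \<inter> C \<noteq> {}"
    proof -
      obtain z where "z \<in> P \<inter> ball y (min d4 \<rho>)" "ray_min g z \<tau>"
        using dense[OF \<tau>(1) b(2)[OF \<tau>(2)], of "min d4 \<rho>"] C(1) \<rho>(1) by auto
      then show ?thesis using C(3) by (auto simp: K1_def)
    qed
    ultimately show False using w(1) nw C(3) by (auto simp: K2_def)
  qed
  \<comment> \<open>At non-positive times every point counts as a survivor.\<close>
  have trivial: "\<exists>\<delta>>0. \<forall>z\<in>P \<inter> ball y \<delta>. c z = c y" if "Good \<tau>" "\<tau> \<le> 0" for \<tau>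
    using that ray_min_nonpos[OF that(2)] unfolding Good_def by blast
  have "Good (b - (1 + real k) * \<eta>)" for k
  proof (induction k)
    case 0
    then show ?case using base by simp
  next
    case (Suc k)
    have eq: "b - (1 + real (Suc k)) * \<eta> = b - (1 + real k) * \<eta> - \<eta>" by (simp add: algebra_simps)
    have "0 < (1 + real k) * \<eta>" using \<eta> by (intro mult_pos_pos) auto
    then show ?case
      using step[OF Suc] trivial[OF Suc] unfolding eq by (cases "0 < b - (1 + real k) * \<eta>") (auto simp: Good_def)
  qed
  moreover obtain k :: nat where "b / \<eta> < real k" using reals_Archimedean2 by blast
  then have "b - (1 + real k) * \<eta> \<le> 0" using \<eta> by (simp add: field_simps)
  ultimately show ?thesis using trivial by blast
qed

section \<open>Each \<open>T g (F g Ei)\<close> is almost connected\<close>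

text \<open>Moving \<open>X g z t\<close> a little in the gradient direction gives a ball in \<open>H g z\<close> on which the minimum
  of \<open>g\<close> exceeds \<open>g z\<close>: a minimizer \<open>w\<close> with \<open>g w = g z\<close> would lie near \<open>z\<close> and be a local minimum
  of \<open>g\<close>, but the gradient does not vanish near \<open>z\<close>.\<close>

lemma superlevel_ray_min_near:
  assumes g: "C1 g" and nz: "grad g z \<noteq> 0" and z: "z \<notin> E g" and t: "0 < t"
    and strict: "ray_strict_min g z t" and \<delta>: "0 < \<delta>"
  obtains w where "g z < g w" "w \<in> ball z \<delta>" "ray_min g w t"
proof -
  define V where "V = ball z \<delta> \<inter> {w. grad g w \<noteq> 0}"
  have "open {w. grad g w \<noteq> 0}"
    using g by (intro open_Collect_neq continuous_intros) (auto simp: C1_def)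
  then have V: "open V" unfolding V_def by (intro open_Int open_ball)
  have "y \<in> V" if "minimizer g (X g z t) t y" for y
    using unique_minimizer_ray_iff[OF g nz, of t] that strict t nz \<delta> by (auto simp: V_def)
  then obtain r where r: "0 < r" "\<And>x y. dist x (X g z t) < r \<Longrightarrow> minimizer g x t y \<Longrightarrow> y \<in> V"
    using minimizers_stable[OF g t _ V] by metis
  have n1: "norm (dir g z) = 1" by (rule norm_dir[OF nz])
  then have nn: "dir g z \<bullet> dir g z = 1" by (simp add: norm_eq_1)
  define x where "x = X g z t + (r / 2) *\<^sub>R dir g z"
  obtain w where w: "minimizer g x t w" using minimizer_exists[OF g] t by (meson less_imp_le)
  have "dist x (X g z t) < r" using r n1 by (simp add: x_def dist_norm)
  then have wV: "w \<in> V" using r(2) w by blast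
  have inH: "v \<in> H g z" if "v \<in> cball x t" for v
  proof -
    have "- t \<le> (v - x) \<bullet> dir g z"
      using Cauchy_Schwarz_ineq2[of "v - x" "dir g z"] that n1 by (simp add: dist_norm norm_minus_commute)
    moreover have "(v - z) \<bullet> dir g z = (v - x) \<bullet> dir g z + t + r / 2"
      by (simp add: x_def X_eq inner_diff_left inner_add_left nn)
    ultimately have "0 < (v - z) \<bullet> dir g z" using r(1) by linarith
    then show ?thesis using nz inner_grad_eq_dir[of "v - z" g z] by (simp add: H_def)
  qed
  have ge: "g z \<le> g v" if "v \<in> H g z" for v using z nz that by (auto simp: E_def not_less)
  have wH: "w \<in> H g z" using inH w by (auto simp: minimizer_iff[OF g])
  have "g w \<noteq> g z"
  proof
    assume eq: "g w = g z"
    have "H g z = {y. grad g z \<bullet> z < grad g z \<bullet> y}"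
      by (simp add: H_def inner_diff_left inner_commute[of "grad g z"])
    then have "open (H g z)" by (simp add: open_halfspace_gt)
    then have "(\<lambda>h. h \<bullet> grad g w) = (\<lambda>h. 0)"
      using ge eq by (intro differential_zero_maxmin[OF wH _ C1_has_derivative[OF g]]) auto
    then have "grad g w \<bullet> grad g w = 0" by (rule fun_cong)
    then show False using wV by (simp add: V_def)
  qed
  then have "g z < g w" using ge[OF wH] by simp
  moreover have "ray_min g w t" using minimizer_ray_min[OF g w] wV by (simp add: V_def)
  ultimately show ?thesis using that wV by (auto simp: V_def)
qed

lemma connected_fibre_image:
  assumes "grad g z \<noteq> 0"
  shows "connected ((\<lambda>t. (X g z t, t)) ` fibre g z)"
proof (rule connected_continuous_image)
  show "continuous_on (fibre g z) (\<lambda>t. (X g z t, t))" unfolding X_eq by (intro continuous_intros)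
  have "is_interval (fibre g z)"
    unfolding is_interval_1 using convex_fibre[OF assms, of _ _] by meson
  then show "connected (fibre g z)" by (rule is_interval_connected)
qed

text \<open>The colour of \<open>z\<close> tells in which of the two separated parts the connected segment over \<open>z\<close>
  lies. It is locally constant on the open connected set \<open>Ei\<close>, and the remaining points of
  \<open>F g Ei\<close> have the colour of nearby points of \<open>Ei\<close> in their superlevel set. In both cases the
  times at which nearby characteristics end are bounded: at a point of \<open>E g\<close> because its own
  characteristic ends, at a point \<open>y\<close> outside because a competitor with value \<open>g y\<close> cuts
  off the points of larger value just after the time \<open>ts_bar g y\<close>.\<close>

theorem almost_connected_T_F:
  assumes g: "C1 g" and Ei: "Ei \<in> path_components (E g)"
  shows "almost_connected (T g (F g Ei))"
  unfolding almost_connected_def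
proof (intro allI impI)
  fix A B
  define D where "D = F g Ei"
  define seg where "seg z = (\<lambda>t. (X g z t, t)) ` fibre g z" for z
  assume "closedin (top_of_set (T g (F g Ei))) A \<and> closedin (top_of_set (T g (F g Ei))) B \<and>
    A \<noteq> {} \<and> B \<noteq> {} \<and> A \<inter> B = {} \<and> T g (F g Ei) = A \<union> B"
  then obtain A' B' where AB: "closed A'" "A = T g D \<inter> A'" "closed B'" "B = T g D \<inter> B'"
    "A \<noteq> {}" "B \<noteq> {}" "A \<inter> B = {}" "T g D = A \<union> B" unfolding D_def closedin_closed by blast
  have DM: "D \<subseteq> M g" unfolding D_def by (rule F_subset_M[OF g Ei])
  then have nzD: "grad g z \<noteq> 0" if "z \<in> D" for z using that M_iff[OF g] by blast
  have TD: "T g D = (\<Union>z\<in>D. seg z)" unfolding seg_def by (rule T_eq_fibres[OF g nzD])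
  note Ei' = path_components_E(3)[OF g Ei]
  have EiD: "Ei \<subseteq> D" by (auto simp: D_def F_def)
  show "setdist A B = 0"
  proof (rule ccontr)
    assume "setdist A B \<noteq> 0"
    then have \<epsilon>: "0 < setdist A B" using setdist_pos_le[of A B] by linarith
    have one_side: "seg z \<subseteq> A \<or> seg z \<subseteq> B" if z: "z \<in> D" for z
    proof -
      have con: "connected (seg z)" unfolding seg_def by (rule connected_fibre_image[OF nzD[OF z]])
      have subT: "seg z \<subseteq> T g D" using z TD by blast
      have "seg z \<subseteq> A' \<union> B'" using subT AB(2,4,8) by blast
      moreover have "A' \<inter> B' \<inter> seg z = {}" using subT AB(2,4,7) by blast
      ultimately have "A' \<inter> seg z = {} \<or> B' \<inter> seg z = {}"
        by (intro connected_closedD[OF con _ _ AB(1,3)])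
      then show ?thesis
      proof
        assume "A' \<inter> seg z = {}"
        then have "seg z \<inter> A = {}" using AB(2) by blast
        then show ?thesis using subT AB(8) by blast
      next
        assume "B' \<inter> seg z = {}"
        then have "seg z \<inter> B = {}" using AB(4) by blast
        then show ?thesis using subT AB(8) by blast
      qed
    qed
    define c where "c z \<longleftrightarrow> seg z \<subseteq> A" for z
    have c: "c z = c w" if zw: "z \<in> D" "w \<in> D" "s \<in> fibre g z" "t \<in> fibre g w"
      "dist (X g z s, s) (X g w t, t) < setdist A B" for z w s t
    proof (rule ccontr)
      assume ne: "c z \<noteq> c w"
      have pq: "(X g z s, s) \<in> seg z" "(X g w t, t) \<in> seg w" using zw by (auto simp: seg_def)
      consider "seg z \<subseteq> A" "seg w \<subseteq> B" | "seg z \<subseteq> B" "seg w \<subseteq> A"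
        using ne one_side[OF zw(1)] one_side[OF zw(2)] unfolding c_def by argo
      then have "(X g z s, s) \<in> A \<and> (X g w t, t) \<in> B \<or> (X g z s, s) \<in> B \<and> (X g w t, t) \<in> A"
        using pq by cases auto
      then have "setdist A B \<le> dist (X g z s, s) (X g w t, t)"
      proof
        assume "(X g z s, s) \<in> A \<and> (X g w t, t) \<in> B"
        then show ?thesis using setdist_le_dist by blast
      next
        assume "(X g z s, s) \<in> B \<and> (X g w t, t) \<in> A"
        then show ?thesis using setdist_le_dist by (metis dist_commute)
      qed
      with zw(5) show False by simp
    qed
    have near_Ei: "\<exists>\<delta>>0. \<forall>z\<in>Ei \<inter> ball y \<delta>. c z = c y" if y: "y \<in> Ei" for y
    proof -
      have yD: "y \<in> D" using y EiD by blast
      obtain x where x: "x \<in> H g y" "g x < g y" using y Ei' by (auto simp: E_def)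
      obtain r0 where r0: "\<And>t. r0 < t \<Longrightarrow> x \<in> ball (X g y t) t"
        using competitor_in_balls[OF nzD[OF yD] x(1)] by blast
      have "t \<le> r0" if m: "ray_min g y t" for t
      proof (rule ccontr)
        assume "\<not> t \<le> r0"
        then have "x \<in> cball (X g y t) t" using r0[of t] by simp
        with m x(2) show False unfolding ray_min_def by force
      qed
      then obtain r where r: "r \<in> fibre g y" "\<And>t. ray_min g y t \<Longrightarrow> t \<le> r"
        using fibre_greatest[OF g nzD[OF yD], of r0] by blast
      show ?thesis
      proof (rule colour_constant_near[where c = c and D = D and P = Ei, OF g \<epsilon> c DM _ EiD yD r(1)])
        show "open Ei" using Ei' by blast
        fix \<eta> :: real assume "0 < \<eta>"
        then have "\<not> ray_min g y (r + \<eta>)" using r(2)[of "r + \<eta>"] by auto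
        then obtain \<delta> where \<delta>: "0 < \<delta>" "\<And>w. dist w y < \<delta> \<Longrightarrow> \<not> ray_min g w (r + \<eta>)"
          using not_ray_min_nhds[OF g nzD[OF yD]] by blast
        have "t \<le> r + \<eta>" if z: "z \<in> Ei \<inter> ball y \<delta>" "ray_min g z t" for z t
        proof (rule ccontr)
          assume "\<not> t \<le> r + \<eta>"
          then have "ray_min g z (r + \<eta>)" using ray_min_mono[OF nzD _ z(2)] z(1) EiD by auto
          then show False using \<delta>(2)[of z] z(1) by (simp add: dist_commute)
        qed
        with \<delta>(1) show "\<exists>\<delta>>0. \<forall>z\<in>Ei \<inter> ball y \<delta>. \<forall>t. ray_min g z t \<longrightarrow> t \<le> r + \<eta>" by blast
      next
        fix \<rho> :: real assume \<rho>: "0 < \<rho>"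
        have "open Ei" using Ei' by blast
        then obtain \<delta> where \<delta>: "0 < \<delta>" "ball y \<delta> \<subseteq> Ei" using y by (rule openE)
        then show "\<exists>\<delta>>0. \<exists>C. connected C \<and> Ei \<inter> ball y \<delta> \<subseteq> C \<and> C \<subseteq> Ei \<inter> ball y \<rho>"
          using \<rho> by (intro exI[of _ "min \<delta> \<rho>"] conjI exI[of _ "ball y (min \<delta> \<rho>)"]) auto
      next
        fix t \<delta> :: real assume "ray_strict_min g y t" "0 < \<delta>"
        then show "\<exists>z\<in>Ei \<inter> ball y \<delta>. ray_min g z t"
          using y ray_strict_min_imp_min by (intro bexI[of _ y]) auto
      qed
    qed
    have near_boundary: "\<exists>z\<in>Ei. c z = c y" if y: "y \<in> D" "y \<notin> Ei" for y
    proof -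
      \<comment> \<open>The characteristic of \<open>y\<close> never ends, but the nearby ones from \<open>P\<close> below end at the latest
        shortly after any given time \<open>r\<close> in \<open>fibre g y\<close>.\<close>
      obtain U where U: "open U" "y \<in> U" "Hplus g U y \<subseteq> Ei" and yM: "y \<in> M g" "y \<notin> E g"
        using y by (auto simp: D_def F_def)
      define P where "P = {w. g y < g w} \<inter> U"
      have PE: "P \<subseteq> Ei" using U(3) by (auto simp: P_def Hplus_def)
      have oP: "open P" unfolding P_def
        using C1_continuous[OF g] U(1) by (intro open_Int open_Collect_less continuous_intros) auto
      note nz = nzD[OF y(1)]
      obtain r where r: "r \<in> fibre g y" using fibre_least[OF g yM(1)] by metis
      then have r': "0 \<le> r" "\<And>s. r < s \<Longrightarrow> \<not> ray_strict_min g y s" by (auto simp: fibre_def)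
      obtain \<rho>0 where \<rho>0: "0 < \<rho>0" "ball y \<rho>0 \<subseteq> U" using openE[OF U(1,2)] by blast
      have conn: "\<exists>\<delta>>0. \<exists>C. connected C \<and> P \<inter> ball y \<delta> \<subseteq> C \<and> C \<subseteq> P \<inter> ball y \<rho>" if \<rho>: "0 < \<rho>" for \<rho>
      proof -
        have "0 < min \<rho> \<rho>0" using \<rho> \<rho>0 by simp
        then obtain \<delta> C where C: "0 < \<delta>" "connected C" "C \<noteq> {}" "{w. g y < g w} \<inter> ball y \<delta> \<subseteq> C"
          "C \<subseteq> {w. g y < g w} \<inter> ball y (min \<rho> \<rho>0)"
          by (rule superlevel_locally_connected[OF g nz])
        have "P \<inter> ball y \<delta> \<subseteq> C" using C(4) unfolding P_def by blast
        moreover have "ball y (min \<rho> \<rho>0) \<subseteq> U \<inter> ball y \<rho>" using \<rho>0(2) by auto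
        then have "C \<subseteq> P \<inter> ball y \<rho>" using C(5) unfolding P_def by blast
        ultimately show ?thesis using C(1,2) by blast
      qed
      have "\<exists>\<delta>>0. \<forall>z\<in>P \<inter> ball y \<delta>. c z = c y"
      proof (rule colour_constant_near[where c = c and D = D and P = P, OF g \<epsilon> c DM oP _ y(1) r _ conn])
        show "P \<subseteq> D" using PE EiD by blast
        fix \<eta> :: real assume \<eta>: "0 < \<eta>"
        obtain x where x: "x \<in> ball (X g y (r + \<eta>)) (r + \<eta>)" "g x = g y"
          using equal_competitor[OF g yM r'(2) _ r'(1), of "r + \<eta>"] \<eta> by auto
        have "((\<lambda>z. dist (X g z (r + \<eta>)) x) \<longlongrightarrow> dist (X g y (r + \<eta>)) x) (nhds y)"
          by (intro tendsto_dist tendsto_const X_tendsto[OF g nz] filterlim_ident)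
        then have "\<forall>\<^sub>F z in nhds y. dist (X g z (r + \<eta>)) x < r + \<eta>"
          using x(1) by (intro order_tendstoD(2)) auto
        then obtain \<delta> where \<delta>: "0 < \<delta>" "\<And>z. dist z y < \<delta> \<Longrightarrow> dist (X g z (r + \<eta>)) x < r + \<eta>"
          by (auto simp: eventually_nhds_metric)
        have "t \<le> r + \<eta>" if z: "z \<in> P \<inter> ball y \<delta>" "ray_min g z t" for z t
        proof (rule ccontr)
          assume "\<not> t \<le> r + \<eta>"
          then have "ray_min g z (r + \<eta>)" using ray_min_mono[OF nzD _ z(2)] z(1) PE EiD by auto
          moreover have "x \<in> cball (X g z (r + \<eta>)) (r + \<eta>)" using \<delta>(2)[of z] z(1) by (simp add: dist_commute)
          ultimately have "g z \<le> g x" unfolding ray_min_def by blast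
          then show False using z(1) x(2) by (simp add: P_def)
        qed
        with \<delta>(1) show "\<exists>\<delta>>0. \<forall>z\<in>P \<inter> ball y \<delta>. \<forall>t. ray_min g z t \<longrightarrow> t \<le> r + \<eta>" by blast
      next
        fix t \<delta> :: real assume *: "0 < t" "ray_strict_min g y t" "0 < \<delta>"
        have "0 < min \<delta> \<rho>0" using *(3) \<rho>0(1) by simp
        then obtain w where w: "g y < g w" "w \<in> ball y (min \<delta> \<rho>0)" "ray_min g w t"
          by (rule superlevel_ray_min_near[OF g nz yM(2) *(1,2)])
        moreover have "ball y (min \<delta> \<rho>0) \<subseteq> U \<inter> ball y \<delta>" using \<rho>0(2) by auto
        ultimately have "w \<in> P \<inter> ball y \<delta>" unfolding P_def by blast
        with w(3) show "\<exists>z\<in>P \<inter> ball y \<delta>. ray_min g z t" by blast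
      qed
      then obtain \<delta> where \<delta>: "0 < \<delta>" "\<And>z. z \<in> P \<inter> ball y \<delta> \<Longrightarrow> c z = c y" by blast
      have "0 < min \<delta> \<rho>0" using \<delta>(1) \<rho>0(1) by simp
      then obtain \<delta>' C where C: "0 < \<delta>'" "connected C" "C \<noteq> {}" "{w. g y < g w} \<inter> ball y \<delta>' \<subseteq> C"
          "C \<subseteq> {w. g y < g w} \<inter> ball y (min \<delta> \<rho>0)"
        by (rule superlevel_locally_connected[OF g nz])
      have "ball y (min \<delta> \<rho>0) \<subseteq> U \<inter> ball y \<delta>" using \<rho>0(2) by auto
      then obtain z where "z \<in> P \<inter> ball y \<delta>" using C(3,5) unfolding P_def by blast
      then show ?thesis using \<delta>(2) PE by blast
    qed
    have Ei_const: "c z = c w" if "z \<in> Ei" "w \<in> Ei" for z w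
    proof -
      have op: "open {v \<in> Ei. c v = k}" for k unfolding open_contains_ball
      proof
        fix v assume v: "v \<in> {v \<in> Ei. c v = k}"
        obtain \<delta> where \<delta>: "0 < \<delta>" "\<forall>z\<in>Ei \<inter> ball v \<delta>. c z = c v" using near_Ei v by blast
        have "open Ei" "v \<in> Ei" using Ei' v by auto
        then obtain \<delta>' where "0 < \<delta>'" "ball v \<delta>' \<subseteq> Ei" by (rule openE)
        moreover have "c w = k" if "w \<in> ball v (min \<delta> \<delta>')" "w \<in> Ei" for w
          using \<delta>(2) v that by (metis (mono_tags) IntI mem_Collect_eq mem_ball min_less_iff_conj)
        ultimately show "\<exists>e>0. ball v e \<subseteq> {v \<in> Ei. c v = k}"
          using \<delta>(1) by (intro exI[of _ "min \<delta> \<delta>'"]) auto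
      qed
      have "{v \<in> Ei. c v = True} \<inter> Ei = {} \<or> {v \<in> Ei. c v = False} \<inter> Ei = {}"
        using Ei' by (intro connectedD[OF _ op op]) auto
      then show ?thesis using that by auto
    qed
    have "c z = c w" if "z \<in> D" "w \<in> D" for z w
      using Ei_const near_boundary that by metis
    moreover obtain z where "z \<in> D" "c z"
    proof -
      obtain p where "p \<in> A" using AB(5) by blast
      moreover then obtain z where "z \<in> D" "p \<in> seg z" using AB(2) TD by blast
      ultimately show ?thesis using that one_side AB(7) unfolding c_def by blast
    qed
    moreover obtain w where "w \<in> D" "\<not> c w"
    proof -
      obtain p where "p \<in> B" using AB(6) by blast
      moreover then obtain z where "z \<in> D" "p \<in> seg z" using AB(4) TD by blast
      ultimately show ?thesis using that AB(7) unfolding c_def by blast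
    qed
    ultimately show False by blast
  qed
qed

section \<open>Almost components\<close>

text \<open>Almost connectedness behaves like connectedness under unions with a common point, because a
  subset of one of two sets at positive distance is still at positive distance from the other.\<close>

lemma almost_connected_Union:
  fixes \<C> :: "'a::metric_space set set"
  assumes con: "\<And>C. C \<in> \<C> \<Longrightarrow> almost_connected C" and p: "\<And>C. C \<in> \<C> \<Longrightarrow> p \<in> C"
  shows "almost_connected (\<Union>\<C>)"
  unfolding almost_connected_def
proof (intro allI impI)
  fix A B
  assume "closedin (top_of_set (\<Union>\<C>)) A \<and> closedin (top_of_set (\<Union>\<C>)) B \<and> A \<noteq> {} \<and> B \<noteq> {} \<and>
    A \<inter> B = {} \<and> \<Union>\<C> = A \<union> B"
  then have AB: "closedin (top_of_set (\<Union>\<C>)) A" "closedin (top_of_set (\<Union>\<C>)) B" "A \<noteq> {}" "B \<noteq> {}"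
    "A \<inter> B = {}" "\<Union>\<C> = A \<union> B" by auto
  show "setdist A B = 0"
  proof (rule ccontr)
    assume ne: "setdist A B \<noteq> 0"
    have side: "C \<subseteq> A \<or> C \<subseteq> B" if C: "C \<in> \<C>" for C
    proof (rule ccontr)
      assume n: "\<not> (C \<subseteq> A \<or> C \<subseteq> B)"
      have "closedin (top_of_set C) (C \<inter> A)" "closedin (top_of_set C) (C \<inter> B)"
        using AB(1,2) C by (auto simp: closedin_closed)
      moreover have "C \<inter> A \<noteq> {}" "C \<inter> B \<noteq> {}" "(C \<inter> A) \<inter> (C \<inter> B) = {}" "C = (C \<inter> A) \<union> (C \<inter> B)"
        using n C AB(5,6) by blast+
      ultimately have "setdist (C \<inter> A) (C \<inter> B) = 0"
        using con[OF C] unfolding almost_connected_def by blast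
      moreover have "setdist A B \<le> setdist (C \<inter> A) (C \<inter> B)"
        using \<open>C \<inter> A \<noteq> {}\<close> \<open>C \<inter> B \<noteq> {}\<close> by (intro order_trans[OF setdist_subset_left setdist_subset_right]) auto
      ultimately show False using ne setdist_pos_le[of A B] by simp
    qed
    obtain a b where "a \<in> A" "b \<in> B" using AB(3,4) by blast
    moreover from this AB(6) obtain Ca Cb where "Ca \<in> \<C>" "a \<in> Ca" "Cb \<in> \<C>" "b \<in> Cb" by blast
    ultimately have "Ca \<subseteq> A" "Cb \<subseteq> B" using side AB(5) by blast+
    then show False using p \<open>Ca \<in> \<C>\<close> \<open>Cb \<in> \<C>\<close> AB(5) by blast
  qed
qed

lemma almost_component_exists:
  assumes "p \<in> K" "K \<subseteq> W" "almost_connected K"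
  obtains C where "C \<in> almost_components W" "K \<subseteq> C"
proof -
  define C where "C = \<Union>{D. D \<subseteq> W \<and> almost_connected D \<and> p \<in> D}"
  have "almost_connected C" unfolding C_def by (rule almost_connected_Union) auto
  moreover have "K \<subseteq> C" "C \<subseteq> W" using assms unfolding C_def by blast+
  moreover have "D = C" if D: "C \<subseteq> D" "D \<subseteq> W" "almost_connected D" for D
  proof (rule equalityI[OF _ D(1)])
    have "p \<in> D" using assms(1) \<open>K \<subseteq> C\<close> D(1) by blast
    with D(2,3) show "D \<subseteq> C" unfolding C_def by blast
  qed
  moreover have "C \<noteq> {}" using assms(1) \<open>K \<subseteq> C\<close> by blast
  ultimately have "C \<in> almost_components W" unfolding almost_components_def by blast
  with \<open>K \<subseteq> C\<close> show ?thesis using that by blast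
qed

lemma almost_component_absorbs:
  assumes C: "C \<in> almost_components W" and K: "almost_connected K" "K \<subseteq> W" "C \<inter> K \<noteq> {}"
  shows "K \<subseteq> C"
proof -
  obtain p where "p \<in> C" "p \<in> K" using K by blast
  then have "almost_connected (\<Union>{C, K})"
    using C K(1) by (intro almost_connected_Union[of _ p]) (auto simp: almost_components_def)
  then have "almost_connected (C \<union> K)" by simp
  moreover have "C \<subseteq> C \<union> K" by blast
  moreover have "C \<union> K \<subseteq> W" using C K(2) unfolding almost_components_def by blast
  ultimately have "C \<union> K = C" using C unfolding almost_components_def by blast
  then show ?thesis by blast
qed

lemma almost_components_countable_union:
  assumes J: "countable J" and W: "W = (\<Union>i\<in>J. K i)" and K: "\<And>i. i \<in> J \<Longrightarrow> almost_connected (K i)"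
  shows "countable (almost_components W)" "\<Union>(almost_components W) = W"
    "\<And>C. C \<in> almost_components W \<Longrightarrow> \<exists>I\<subseteq>J. C = (\<Union>i\<in>I. K i)"
proof -
  have KW: "K i \<subseteq> W" if "i \<in> J" for i using W that by blast
  have sub: "C \<subseteq> W" "C \<noteq> {}" if "C \<in> almost_components W" for C
    using that by (auto simp: almost_components_def)
  have absorb: "K i \<subseteq> C" if "C \<in> almost_components W" "i \<in> J" "C \<inter> K i \<noteq> {}" for C i
    using almost_component_absorbs[OF that(1) K KW] that by blast
  show "\<exists>I\<subseteq>J. C = (\<Union>i\<in>I. K i)" if C: "C \<in> almost_components W" for C
  proof (intro exI conjI)
    show "C = (\<Union>i\<in>{i\<in>J. C \<inter> K i \<noteq> {}}. K i)" using absorb[OF C] sub[OF C] W by blast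
  qed blast
  show "\<Union>(almost_components W) = W"
  proof
    show "W \<subseteq> \<Union>(almost_components W)"
    proof
      fix p assume "p \<in> W"
      then obtain i where i: "i \<in> J" "p \<in> K i" using W by blast
      then show "p \<in> \<Union>(almost_components W)"
        using almost_component_exists[OF i(2) KW K] by blast
    qed
  qed (use sub in blast)
  have "\<exists>i\<in>J. C \<inter> K i \<noteq> {}" if "C \<in> almost_components W" for C using sub[OF that] W by blast
  then obtain f where f: "\<And>C. C \<in> almost_components W \<Longrightarrow> f C \<in> J \<and> C \<inter> K (f C) \<noteq> {}" by metis
  have "inj_on f (almost_components W)"
  proof (rule inj_onI)
    fix C D assume CD: "C \<in> almost_components W" "D \<in> almost_components W" "f C = f D"
    have "K (f C) \<subseteq> C" using absorb f CD(1) by blast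
    then have ne: "D \<inter> C \<noteq> {}" using f[OF CD(2)] CD(3) by auto
    have ac: "almost_connected C" "almost_connected D" using CD by (auto simp: almost_components_def)
    show "C = D"
      using almost_component_absorbs[OF CD(1) ac(2) sub(1)[OF CD(2)]]
        almost_component_absorbs[OF CD(2) ac(1) sub(1)[OF CD(1)]] ne by blast
  qed
  moreover have "countable (f ` almost_components W)" using f J by (meson countable_subset image_subsetI)
  ultimately show "countable (almost_components W)" by (rule countable_image_inj_on[rotated])
qed

section \<open>The decomposition of the singular set together with \<open>T1 g\<close>\<close>

theorem theorem3p36:
  fixes g :: "real^'n \<Rightarrow> real"
  assumes "C1 g"
  shows "\<exists>\<S>. countable \<S> \<and> Sigma_sing g \<union> T1 g = \<Union>\<S> \<and>
    (\<forall>S\<in>\<S>. (S \<in> components (Sigma_sing g \<union> T1 g) \<or> S \<in> almost_components (Sigma_sing g \<union> T1 g)) \<and>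
       (\<exists>I. I \<subseteq> path_components (E g) \<and> countable I \<and> S = (\<Union>Ei\<in>I. T g (F g Ei))))"
proof -
  define W where "W = Sigma_sing g \<union> T1 g"
  have "T g (M g) = (\<Union>Ei\<in>path_components (E g). T g (F g Ei))"
    unfolding M_eq_Union_F[OF assms] by (auto simp: T_def)
  then have W: "W = (\<Union>Ei\<in>path_components (E g). T g (F g Ei))"
    unfolding W_def by (simp add: Sigma_T1_eq[OF assms])
  note cnt = path_components_E(1)[OF assms]
  have comps: "countable (almost_components W)" "\<Union>(almost_components W) = W"
    "\<And>S. S \<in> almost_components W \<Longrightarrow> \<exists>I\<subseteq>path_components (E g). S = (\<Union>Ei\<in>I. T g (F g Ei))"
    using almost_components_countable_union[OF cnt W] almost_connected_T_F[OF assms] by blast+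
  have "\<exists>I. I \<subseteq> path_components (E g) \<and> countable I \<and> S = (\<Union>Ei\<in>I. T g (F g Ei))"
    if "S \<in> almost_components W" for S
    using comps(3)[OF that] countable_subset[OF _ cnt] by blast
  then show ?thesis
    unfolding W_def[symmetric] using comps(1,2) by (intro exI[of _ "almost_components W"]) auto
qed

end
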